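(* Let $q\ge 2$ be an integer, let $a>0$ be real and let $\mathbf{x}_0=(x_1,\dots,x_q)\in\mathbb{R}_{>0}^q$. Let $(\mathbf{X}_n)_{n\ge0}$ be the Pólya urn with $q$ colours, replacement parameter $a$ and initial state $\mathbf{X}_0=\mathbf{x}_0$, and let $Y_{n,i}$ be the number of draws of colour $i$ among the first $n$ draws. Let $i\in\{1,\dots,q\}$, let $W_i\sim\mathrm{Beta}\bigl(x_i/a,(|\mathbf{x}_0|-x_i)/a\bigr)$, and let $$\rho:=\min\Bigl\{\frac{x_i}{a},\frac{|\mathbf{x}_0|-x_i}{a},1\Bigr\}.$$ Then there exist constants $0<c\le C<\infty$, which may depend on $q$, $a$ and $\mathbf{x}_0$ but not on $n$, such that for all integers $n\ge1$, $$c\,n^{-\rho}\le d_{\mathrm{KS}}\Bigl(\frac{X_{n,i}}{|\mathbf{X}_n|},W_i\Bigr)\le C\,n^{-\rho}\qquad\text{and}\qquad c\,n^{-\rho}\le d_{\mathrm{KS}}\Bigl(\frac{Y_{n,i}}{n},W_i\Bigr)\le C\,n^{-\rho}.$$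
   Context: Norm: for $\mathbf{x}\in\mathbb{R}^q$, $|\mathbf{x}|:=\sum_{i=1}^q|x_i|$. Pólya urn: given $q\ge2$, $a>0$ and $\mathbf{x}_0\in\mathbb{R}_{>0}^q$ (the entries need not be integers), the urn is the Markov chain $\mathbf{X}_n=(X_{n,1},\dots,X_{n,q})$, $n\ge0$, in $\mathbb{R}_{>0}^q$ with deterministic initial value $\mathbf{X}_0=\mathbf{x}_0$ and transition probabilities $$\mathbb{P}(\mathbf{X}_{n+1}=\mathbf{X}_n+a\mathbf{e}_i\mid\mathbf{X}_n)=\frac{X_{n,i}}{|\mathbf{X}_n|},\qquad i=1,\dots,q,$$ where $\mathbf{e}_1,\dots,\mathbf{e}_q$ are the standard unit vectors. Thus $|\mathbf{X}_n|=an+|\mathbf{x}_0|$ is deterministic. The vector $\mathbf{Y}_n=(Y_{n,1},\dots,Y_{n,q})$, where $Y_{n,i}$ is the number of steps among the first $n$ in which colour $i$ is drawn (i.e. $a\mathbf{e}_i$ is added), satisfies $\mathbf{X}_n=\mathbf{x}_0+a\mathbf{Y}_n$. Beta distribution: for $\alpha,\beta>0$, $\mathrm{Beta}(\alpha,\beta)$ has density $B(\alpha,\beta)^{-1}x^{\alpha-1}(1-x)^{\beta-1}$ on $0<x<1$, with $B(\alpha,\beta)=\Gamma(\alpha)\Gamma(\beta)/\Gamma(\alpha+\beta)$. Kolmogorov–Smirnov distance: for real random variables $X,Y$, $d_{\mathrm{KS}}(X,Y):=\sup_{x\in\mathbb{R}}|\mathbb{P}(X\le x)-\mathbb{P}(Y\le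 x)|$. *)

theory Defs
  imports "HOL-Probability.Probability"
begin

definition l1_norm :: "real ^ 'q \<Rightarrow> real" where
  "l1_norm x = (\<Sum>i\<in>UNIV. \<bar>x $ i\<bar>)"

(* The urn process is discrete, so "Markov chain with the given transition probabilities" is
   stated elementarily, by conditioning on every history (s 0, ..., s n) of positive
   probability.  For a > 0 and x0 with positive entries, the transition probabilities out of a
   reachable state sum to 1, so almost surely every X n has positive entries; this is therefore
   not a separate assumption. *)
locale polya_urn = prob_space M
  for M :: "'w measure" and a :: real and x0 :: "real ^ 'q" and X :: "nat \<Rightarrow> 'w \<Rightarrow> real ^ 'q" +
  assumes random_variable_X: "\<And>n. random_variable borel (X n)"
    and initial: "AE \<omega> in M. X 0 \<omega> = x0"
    and transition: "\<And>n s i. \<P>(\<omega> in M. \<forall>k\<le>n. X k \<omega> = s k) > 0 \<Longrightarrow>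
      \<P>(\<omega> in M. X (Suc n) \<omega> = X n \<omega> + a *\<^sub>R axis i 1 \<bar> \<forall>k\<le>n. X k \<omega> = s k)
        = s n $ i / l1_norm (s n)"

definition draws :: "real \<Rightarrow> (nat \<Rightarrow> 'w \<Rightarrow> real ^ 'q) \<Rightarrow> nat \<Rightarrow> 'q \<Rightarrow> 'w \<Rightarrow> nat" where
  "draws a X n i \<omega> = card {k. k < n \<and> X (Suc k) \<omega> = X k \<omega> + a *\<^sub>R axis i 1}"

definition beta_density :: "real \<Rightarrow> real \<Rightarrow> real \<Rightarrow> real" where
  "beta_density \<alpha> \<beta> x =
    (if 0 < x \<and> x < 1 then x powr (\<alpha> - 1) * (1 - x) powr (\<beta> - 1) / Beta \<alpha> \<beta> else 0)"

(* The two random variables may live on different probability spaces. *)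
definition ks_dist :: "'w measure \<Rightarrow> ('w \<Rightarrow> real) \<Rightarrow> 'v measure \<Rightarrow> ('v \<Rightarrow> real) \<Rightarrow> real" where
  "ks_dist M X N Y =
    (SUP x. \<bar>\<P>(\<omega> in M. X \<omega> \<le> x) - \<P>(\<omega> in N. Y \<omega> \<le> x)\<bar>)"

end

theory Submission
  imports Defs
begin

text \<open>
  With \<open>\<alpha> = x\<^sub>i / a\<close> and \<open>\<beta> = (|x\<^sub>0| - x\<^sub>i) / a\<close>, the number \<open>Y\<close> of draws of colour \<open>i\<close> is
  beta-binomial, and \<open>X\<^sub>n\<^sub>,\<^sub>i / |X\<^sub>n| = (Y + \<alpha>) / (n + \<alpha> + \<beta>)\<close> almost surely.

  For the upper bound, let \<open>G\<close> be the beta distribution function and \<open>g\<close> its density. For \<open>k < n\<close>,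
  \<open>P(Y \<le> k)\<close> is the expectation of \<open>G(U)\<close> where \<open>U\<close> has the law \<open>Beta(k+1, n-k)\<close>, whose mean is
  \<open>m = (k+1)/(n+1)\<close> and whose variance is \<open>m(1-m)/(n+2)\<close>. The singularities of \<open>G\<close> at the end points are
  controlled by \<open>|G(u) - G(m) - g(m)(u-m)| \<le> K (m(1-m))\<^sup>\<rho>\<^sup>-\<^sup>2 (u-m)\<^sup>2\<close>; taking expectations gives
  \<open>P(Y \<le> k) = G(m) + O(n\<^sup>-\<^sup>\<rho>)\<close>, and \<open>\<rho>\<close>-Hoelder continuity of \<open>G\<close> extends this to all arguments.

  For the lower bound, \<open>G\<close> is continuous, so the distance is at least half of every atom of \<open>Y\<close>.
  The atoms at \<open>0\<close> and \<open>n\<close> are of order \<open>n\<^sup>-\<^sup>\<alpha>\<close> and \<open>n\<^sup>-\<^sup>\<beta>\<close>, and some atom is at least \<open>1/(n+1)\<close>.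
\<close>

subsection \<open>The law of the number of draws\<close>

text \<open>Rising factorials are successive urn contents divided by a: k draws of a colour with
  initial content x contribute x (x + a) ... (x + (k - 1) a), which is
  \<open>a ^ k * pochhammer (x / a) k\<close>. The powers of a cancel in the quotient.\<close>

definition beta_binomial :: "real \<Rightarrow> real \<Rightarrow> nat \<Rightarrow> nat \<Rightarrow> real" where
  "beta_binomial \<alpha> \<beta> n k =
    real (n choose k) * pochhammer \<alpha> k * pochhammer \<beta> (n - k) / pochhammer (\<alpha> + \<beta>) n"

lemma beta_binomial_nonneg: "\<alpha> > 0 \<Longrightarrow> \<beta> > 0 \<Longrightarrow> beta_binomial \<alpha> \<beta> n k \<ge> 0"
  by (auto simp: beta_binomial_def intro!: divide_nonneg_nonneg mult_nonneg_nonneg pochhammer_nonneg)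

lemma beta_binomial_Suc_0:
  "beta_binomial \<alpha> \<beta> (Suc n) 0 = (\<beta> + n) / (\<alpha> + \<beta> + n) * beta_binomial \<alpha> \<beta> n 0"
  by (simp add: beta_binomial_def pochhammer_Suc mult_ac)

text \<open>The last draw either adds the colour or does not. Pascal's rule splits the binomial
  coefficient accordingly, and in each summand one rising factorial of the numerator gives up its
  last factor.\<close>

lemma beta_binomial_Suc_Suc:
  assumes "\<alpha> > 0" "\<beta> > 0" "k \<le> n"
  shows "beta_binomial \<alpha> \<beta> (Suc n) (Suc k) =
    (\<alpha> + k) / (\<alpha> + \<beta> + n) * beta_binomial \<alpha> \<beta> n k +
    (\<beta> + n - Suc k) / (\<alpha> + \<beta> + n) * beta_binomial \<alpha> \<beta> n (Suc k)"
proof (cases "k = n")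
  \<comment> \<open>For k = n the truncated difference \<open>n - Suc k\<close> cannot be unfolded,
    but the second summand vanishes with \<open>n choose Suc n\<close>.\<close>
  case True
  then show ?thesis by (simp add: beta_binomial_def pochhammer_Suc binomial_eq_0 mult_ac)
next
  case False
  with assms have *: "n - k = Suc (n - Suc k)" by simp
  have "real (n - Suc k) = real n - Suc k" using False assms by simp
  then have **: "pochhammer \<beta> (n - k) = pochhammer \<beta> (n - Suc k) * (\<beta> + n - Suc k)"
    unfolding * pochhammer_Suc by simp
  \<comment> \<open>Here c, c' are the Pascal coefficients and s, t, d the last factors of the three
    rising factorials.\<close>
  have "(c + c') * (A * s) * (B * t) / (D * d) = s / d * (c * A * (B * t) / D) + t / d * (c' * (A * s) * B / D)"
    for c c' A s B t D d :: real
    by (simp add: distrib_left distrib_right add_divide_distrib mult_ac)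
  then show ?thesis
    unfolding beta_binomial_def pochhammer_Suc binomial_Suc_Suc diff_Suc_Suc ** of_nat_add by blast
qed

text \<open>The recursion transposed onto a test function: the mean of f after n + 1 draws is the
  mean after n draws of its one-step average. The sums over urn histories will obey the same
  recursion.\<close>

lemma beta_binomial_sum_Suc:
  fixes f :: "nat \<Rightarrow> real"
  assumes "\<alpha> > 0" "\<beta> > 0"
  shows "(\<Sum>k\<le>Suc n. beta_binomial \<alpha> \<beta> (Suc n) k * f k) =
    (\<Sum>k\<le>n. beta_binomial \<alpha> \<beta> n k *
      ((\<alpha> + k) / (\<alpha> + \<beta> + n) * f (Suc k) + (\<beta> + n - k) / (\<alpha> + \<beta> + n) * f k))"
proof -
  let ?B = "beta_binomial \<alpha> \<beta>" and ?d = "\<alpha> + \<beta> + n"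
  let ?q = "\<lambda>k. (\<beta> + n - real k) / ?d * ?B n k * f k"
  have "(\<Sum>k\<le>Suc n. ?B (Suc n) k * f k) =
      ?B (Suc n) 0 * f 0 + (\<Sum>k\<le>n. ?B (Suc n) (Suc k) * f (Suc k))"
    by (rule sum.atMost_Suc_shift)
  also have "\<dots> = (\<Sum>k\<le>n. (\<alpha> + k) / ?d * ?B n k * f (Suc k)) + (?q 0 + (\<Sum>k\<le>n. ?q (Suc k)))"
    using beta_binomial_Suc_Suc[OF assms]
    by (simp add: beta_binomial_Suc_0 sum.distrib[symmetric] distrib_right)
  also have "?q 0 + (\<Sum>k\<le>n. ?q (Suc k)) = (\<Sum>k\<le>Suc n. ?q k)"
    by (rule sum.atMost_Suc_shift[symmetric])
  \<comment> \<open>The summand at \<open>Suc n\<close> is zero because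
    \<open>n choose Suc n\<close> is.\<close>
  also have "\<dots> = (\<Sum>k\<le>n. ?q k)"
    by (simp add: beta_binomial_def)
  moreover have "u * b * y + v * b * z = b * (u * y + v * z)" for u v b y z :: real
    by (simp add: algebra_simps)
  ultimately show ?thesis
    by (simp only: sum.distrib[symmetric])
qed

lemma beta_binomial_sum:
  assumes "\<alpha> > 0" "\<beta> > 0"
  shows "(\<Sum>k\<le>n. beta_binomial \<alpha> \<beta> n k) = 1"
proof (induction n)
  case (Suc n)
  have "\<alpha> + \<beta> + n \<noteq> 0" using assms by (simp add: add_pos_nonneg)
  then have "(\<alpha> + k) / (\<alpha> + \<beta> + n) + (\<beta> + n - k) / (\<alpha> + \<beta> + n) = 1" for k
    by (simp add: divide_simps)
  then have "(\<Sum>k\<le>Suc n. beta_binomial \<alpha> \<beta> (Suc n) k) = (\<Sum>k\<le>n. beta_binomial \<alpha> \<beta> n k)"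
    using beta_binomial_sum_Suc[OF assms, of n "\<lambda>_. 1"] by simp
  with Suc show ?case by simp
qed (simp add: beta_binomial_def)

section \<open>Colour words and the urn paths they determine\<close>

primrec urn_state :: "real \<Rightarrow> real ^ 'q \<Rightarrow> 'q list \<Rightarrow> real ^ 'q" where
  "urn_state a x0 [] = x0"
| "urn_state a x0 (j # w) = urn_state a x0 w + a *\<^sub>R axis j 1"

lemma urn_state_nth: "urn_state a x0 w $ i = x0 $ i + a * count_list w i"
  by (induction w) (auto simp: axis_def algebra_simps)

lemma l1_norm_urn_state:
  fixes x0 :: "real ^ 'q"
  assumes "a > 0" "\<And>j. x0 $ j > 0"
  shows "l1_norm (urn_state a x0 w) = l1_norm x0 + a * length w"
proof -
  have *: "urn_state a x0 w $ i > 0" for w i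
    using assms by (simp add: urn_state_nth add_pos_nonneg)
  show ?thesis
  proof (induction w)
    case (Cons j w)
    have "l1_norm (urn_state a x0 (j # w)) = (\<Sum>i\<in>UNIV. urn_state a x0 (j # w) $ i)"
      using *[of "j # w"] by (auto simp: l1_norm_def less_imp_le intro!: sum.cong)
    also have "\<dots> = (\<Sum>i\<in>UNIV. urn_state a x0 w $ i) + (\<Sum>i\<in>UNIV. if i = j then a else 0)"
      unfolding sum.distrib[symmetric] by (intro sum.cong) (auto simp: axis_def)
    also have "(\<Sum>i\<in>UNIV. urn_state a x0 w $ i) = l1_norm (urn_state a x0 w)"
      using *[of w] by (auto simp: l1_norm_def less_imp_le intro!: sum.cong)
    finally show ?case using Cons by (simp add: algebra_simps)
  qed simp
qed

text \<open>The words list the drawn colours with the most recent draw first.\<close>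

definition history :: "'w measure \<Rightarrow> real \<Rightarrow> real ^ 'q \<Rightarrow> (nat \<Rightarrow> 'w \<Rightarrow> real ^ 'q) \<Rightarrow> 'q list \<Rightarrow> 'w set" where
  "history M a x0 X w =
    {\<omega> \<in> space M. \<forall>k\<le>length w. X k \<omega> = urn_state a x0 (drop (length w - k) w)}"

text \<open>A letter added at the front leaves the suffixes read at times up to
  \<open>length w\<close> unchanged.\<close>

lemma history_Cons:
  "history M a x0 X (j # w) =
    {\<omega> \<in> history M a x0 X w. X (Suc (length w)) \<omega> = urn_state a x0 w + a *\<^sub>R axis j 1}"
  by (auto simp: history_def le_Suc_eq all_conj_distrib Suc_diff_le)

lemma draws_history:
  assumes "a > 0" "\<omega> \<in> history M a x0 X w"
  shows "draws a X (length w) i \<omega> = count_list w i"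
  using assms(2)
proof (induction w)
  case Nil
  then show ?case by (simp add: draws_def)
next
  case (Cons j w)
  then have h: "\<omega> \<in> history M a x0 X w" and
    s: "X (Suc (length w)) \<omega> = urn_state a x0 w + a *\<^sub>R axis j 1"
    by (auto simp: history_Cons)
  have "X (length w) \<omega> = urn_state a x0 w"
    using h by (simp add: history_def)
  then have "X (Suc (length w)) \<omega> = X (length w) \<omega> + a *\<^sub>R axis i 1 \<longleftrightarrow> i = j"
    using s \<open>a > 0\<close> by (auto simp: axis_eq_axis)
  then have "{k. k < length (j # w) \<and> X (Suc k) \<omega> = X k \<omega> + a *\<^sub>R axis i 1} =
     {k. k < length w \<and> X (Suc k) \<omega> = X k \<omega> + a *\<^sub>R axis i 1} \<union> (if i = j then {length w} else {})"
    by (auto simp: less_Suc_eq)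
  then show ?case
    using Cons.IH[OF h] by (auto simp: draws_def)
qed

text \<open>The path determines the word: since a > 0, each increment identifies its colour.\<close>

lemma disjoint_history:
  fixes x0 :: "real ^ 'q"
  assumes "a > 0"
  shows "disjoint_family_on (history M a x0 X) {w. length w = n}"
proof -
  have "w = w'" if "\<omega> \<in> history M a x0 X w" "\<omega> \<in> history M a x0 X w'" "length w = length w'" for \<omega> w w'
    using that(3,1,2)
  proof (induction rule: list_induct2)
    case (Cons j w j' w')
    then have w: "w = w'" by (auto simp: history_Cons)
    have "a *\<^sub>R axis j 1 = (a *\<^sub>R axis j' 1 :: real ^ 'q)"
      using Cons w by (simp add: history_Cons)
    with assms w show ?case by (simp add: axis_eq_axis)
  qed simp
  then show ?thesis unfolding disjoint_family_on_def by fastforce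
qed

lemma finite_words: "finite {w :: 'q :: finite list. length w = n}"
  using finite_lists_length_eq[of "UNIV :: 'q set" n] by simp

lemma sum_words_Suc:
  "(\<Sum>w | length w = Suc n. f w) = (\<Sum>w | length w = n. \<Sum>j\<in>UNIV. f ((j :: 'q :: finite) # w))"
proof -
  have "{w. length w = Suc n} = (\<lambda>(w, j). j # w) ` ({w. length w = n} \<times> (UNIV :: 'q set))"
    using lists_length_Suc_eq[of "UNIV :: 'q set" n] by simp
  then have "(\<Sum>w | length w = Suc n. f w) =
      (\<Sum>(w, j)\<in>{w. length w = n} \<times> UNIV. f ((j :: 'q) # w))"
    by (simp add: sum.reindex inj_on_def split_def)
  then show ?thesis by (simp add: sum.cartesian_product)
qed

context polya_urn
begin

lemma sets_step [measurable]:
  "{\<omega> \<in> space M. X m \<omega> = X n \<omega> + v} \<in> sets M" "{\<omega> \<in> space M. X m \<omega> = v} \<in> sets M"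
proof -
  note random_variable_X[measurable]
  show "{\<omega> \<in> space M. X m \<omega> = X n \<omega> + v} \<in> sets M" "{\<omega> \<in> space M. X m \<omega> = v} \<in> sets M"
    by measurable
qed

lemma sets_history [measurable]: "history M a x0 X w \<in> sets M"
  unfolding history_def by measurable

lemma measurable_draws [measurable]: "draws a X n i \<in> measurable M (count_space UNIV)"
proof -
  have "draws a X n i = (\<lambda>\<omega>. \<Sum>k<n. of_bool (X (Suc k) \<omega> = X k \<omega> + a *\<^sub>R axis i 1))"
    by (simp add: draws_def fun_eq_iff lessThan_def Collect_conj_eq)
  also have "\<dots> \<in> measurable M (count_space UNIV)"
    by measurable
  finally show ?thesis .
qed

lemma measurable_proportion [measurable]: "(\<lambda>\<omega>. X n \<omega> $ i / l1_norm (X n \<omega>)) \<in> borel_measurable M"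
proof -
  note random_variable_X[measurable]
  have [measurable]: "(\<lambda>\<omega>. X n \<omega> $ j) \<in> borel_measurable M" for j
    using borel_measurable_continuous_onI[of "\<lambda>x::real^'q. x $ j"]
    by (auto intro!: measurable_compose[OF random_variable_X] continuous_intros)
  show ?thesis unfolding l1_norm_def by measurable
qed

text \<open>The chain rule. \<open>transition\<close> speaks only of histories of positive
  probability; a null history has null extensions, so the product formula persists there.\<close>

lemma prob_history_Cons:
  assumes "a > 0"
  shows "prob (history M a x0 X (j # w)) =
    prob (history M a x0 X w) * (urn_state a x0 w $ j / l1_norm (urn_state a x0 w))"
proof (cases "prob (history M a x0 X w) > 0")
  case True
  define s where "s = (\<lambda>k. urn_state a x0 (drop (length w - k) w))"
  have h: "{\<omega> \<in> space M. \<forall>k\<le>length w. X k \<omega> = s k} = history M a x0 X w"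
    by (simp add: history_def s_def)
  have sl: "s (length w) = urn_state a x0 w"
    by (simp add: s_def)
  have "{\<omega> \<in> space M. X (Suc (length w)) \<omega> = X (length w) \<omega> + a *\<^sub>R axis j 1 \<and> (\<forall>k\<le>length w. X k \<omega> = s k)}
      = history M a x0 X (j # w)"
    unfolding history_Cons h[symmetric] using sl by auto
  with transition[of "length w" s j] True show ?thesis
    unfolding h cond_prob_def sl by (auto simp: field_simps)
next
  case False
  then have "prob (history M a x0 X w) = 0"
    using measure_nonneg[of M "history M a x0 X w"] by linarith
  moreover from this have "prob (history M a x0 X (j # w)) \<le> 0"
    using finite_measure_mono[of "history M a x0 X (j # w)" "history M a x0 X w"]
    by (auto simp: history_Cons)
  ultimately show ?thesis
    using measure_nonneg[of M "history M a x0 X (j # w)"] by simp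
qed

text \<open>All colours other than i leave the count fixed, so only their total content enters, and
  the count evolves as in a two-colour urn.\<close>

lemma sum_history_Suc:
  fixes f :: "nat \<Rightarrow> real" and i :: 'q
  assumes a: "a > 0" and x0: "\<And>j. x0 $ j > 0"
  defines "\<alpha> \<equiv> x0 $ i / a" and "\<beta> \<equiv> (l1_norm x0 - x0 $ i) / a"
  shows "(\<Sum>w | length w = Suc n. prob (history M a x0 X w) * f (count_list w i)) =
    (\<Sum>w | length w = n. prob (history M a x0 X w) *
       ((\<alpha> + count_list w i) / (\<alpha> + \<beta> + n) * f (Suc (count_list w i)) +
        (\<beta> + n - count_list w i) / (\<alpha> + \<beta> + n) * f (count_list w i)))"
  unfolding sum_words_Suc
proof (rule sum.cong, goal_cases)
  case (2 w)
  then have n: "length w = n" by simp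
  let ?s = "urn_state a x0 w" and ?c = "count_list w i"
  let ?l = "l1_norm x0 + a * n"
  have l: "l1_norm ?s = ?l" using l1_norm_urn_state[OF a x0, of w] n by simp
  have pos: "?s $ j > 0" for j using a x0 by (simp add: urn_state_nth add_pos_nonneg)
  have "l1_norm ?s = (\<Sum>j\<in>UNIV. ?s $ j)"
    unfolding l1_norm_def using pos by (intro sum.cong) (auto simp: less_imp_le)
  then have lsum: "?l = ?s $ i + (\<Sum>j\<in>-{i}. ?s $ j)"
    unfolding l Compl_eq_Diff_UNIV using sum.remove[of UNIV i "\<lambda>j. ?s $ j"] by simp
  have "l1_norm x0 > 0" unfolding l1_norm_def
    by (rule sum_pos) (use x0 in \<open>auto simp: abs_of_pos\<close>)
  then have lpos: "?l > 0" using a by (simp add: add_pos_nonneg)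
  \<comment> \<open>Dividing all contents by a turns them into the parameters of the beta-binomial
    recursion.\<close>
  have d: "\<alpha> + \<beta> + n = ?l / a" and e: "\<beta> + n - ?c = (?l - ?s $ i) / a"
    and e': "\<alpha> + ?c = ?s $ i / a"
    using a by (simp_all add: \<alpha>_def \<beta>_def urn_state_nth field_simps)
  have "(\<Sum>j\<in>UNIV. prob (history M a x0 X (j # w)) * f (count_list (j # w) i)) =
      prob (history M a x0 X w) * (\<Sum>j\<in>UNIV. ?s $ j / ?l * f (count_list (j # w) i))"
    unfolding prob_history_Cons[OF a] l by (simp add: sum_distrib_left mult.assoc)
  also have "(\<Sum>j\<in>UNIV. ?s $ j / ?l * f (count_list (j # w) i)) =
      ?s $ i / ?l * f (Suc ?c) + (\<Sum>j\<in>-{i}. ?s $ j / ?l * f ?c)"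
    by (subst sum.remove[of _ i]) (auto simp: Compl_eq_Diff_UNIV intro!: sum.cong)
  also have "(\<Sum>j\<in>-{i}. ?s $ j / ?l * f ?c) = (?l - ?s $ i) / ?l * f ?c"
    unfolding lsum by (simp add: sum_distrib_right sum_divide_distrib)
  also have "?s $ i / ?l = (\<alpha> + ?c) / (\<alpha> + \<beta> + n)"
    unfolding d e' using a by simp
  also have "(?l - ?s $ i) / ?l = (\<beta> + n - ?c) / (\<alpha> + \<beta> + n)"
    unfolding d e using a by simp
  finally show ?case .
qed simp

text \<open>Both sides satisfy the same one-step recursion. f is arbitrary in the induction because
  each step replaces it by its one-step average.\<close>

lemma sum_history:
  fixes f :: "nat \<Rightarrow> real" and i :: 'q
  assumes a: "a > 0" and x0: "\<And>j. x0 $ j > 0"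
  defines "\<alpha> \<equiv> x0 $ i / a" and "\<beta> \<equiv> (l1_norm x0 - x0 $ i) / a"
  assumes \<beta>: "\<beta> > 0"
  shows "(\<Sum>w | length w = n. prob (history M a x0 X w) * f (count_list w i)) =
    (\<Sum>k\<le>n. beta_binomial \<alpha> \<beta> n k * f k)"
proof (induction n arbitrary: f)
  case 0
  have "prob (history M a x0 X []) = 1"
    using initial by (auto simp: history_def intro!: prob_eq_1[THEN iffD2])
  moreover have "{w :: 'q list. length w = 0} = {[]}" by auto
  ultimately show ?case by (simp add: beta_binomial_def)
next
  case (Suc n)
  have \<alpha>: "\<alpha> > 0" using a x0 by (simp add: \<alpha>_def)
  show ?case
    unfolding sum_history_Suc[OF a x0, where i = i, folded \<alpha>_def \<beta>_def] beta_binomial_sum_Suc[OF \<alpha> \<beta>]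
    by (rule Suc.IH)
qed

text \<open>The histories of length n are disjoint and finite in number, and
  \<open>sum_history\<close> with f constantly 1 shows that their probabilities sum to 1.\<close>

lemma AE_history:
  assumes a: "a > 0" and x0: "\<And>j. x0 $ j > 0" and \<beta>: "(l1_norm x0 - x0 $ i) / a > 0"
  shows "AE \<omega> in M. \<exists>w. length w = n \<and> \<omega> \<in> history M a x0 X w"
proof -
  have \<alpha>: "x0 $ i / a > 0" using a x0 by simp
  have "prob (\<Union>w\<in>{w. length w = n}. history M a x0 X w) = (\<Sum>w | length w = n. prob (history M a x0 X w))"
    by (intro finite_measure_finite_Union finite_words disjoint_history a) auto
  also have "\<dots> = 1"
    using sum_history[OF a x0 \<beta>, where f = "\<lambda>_. 1" and n = n] beta_binomial_sum[OF \<alpha> \<beta>, of n] by simp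
  finally have "AE \<omega> in M. \<omega> \<in> (\<Union>w\<in>{w. length w = n}. history M a x0 X w)"
    by (intro AE_prob_1)
  then show ?thesis by eventually_elim auto
qed

lemma AE_proportion:
  fixes i :: 'q
  assumes a: "a > 0" and x0: "\<And>j. x0 $ j > 0"
  defines "\<alpha> \<equiv> x0 $ i / a" and "\<beta> \<equiv> (l1_norm x0 - x0 $ i) / a"
  assumes \<beta>: "\<beta> > 0"
  shows "AE \<omega> in M. X n \<omega> $ i / l1_norm (X n \<omega>) = (real (draws a X n i \<omega>) + \<alpha>) / (real n + (\<alpha> + \<beta>))"
  using AE_history[OF a x0 \<beta>[unfolded \<beta>_def], of n]
proof eventually_elim
  case (elim \<omega>)
  then obtain w where w: "length w = n" "\<omega> \<in> history M a x0 X w" by auto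
  then have X: "X n \<omega> = urn_state a x0 w" by (auto simp: history_def)
  have "n + (\<alpha> + \<beta>) = (l1_norm x0 + a * n) / a"
    using a by (simp add: \<alpha>_def \<beta>_def field_simps)
  moreover have "draws a X n i \<omega> + \<alpha> = (x0 $ i + a * count_list w i) / a"
    using draws_history[OF a w(2), of i] w a by (simp add: \<alpha>_def field_simps)
  ultimately show ?case
    unfolding X l1_norm_urn_state[OF a x0] urn_state_nth w(1) using a by simp
qed

text \<open>Up to a null set the event is a finite disjoint union of histories, on each of which the
  number of draws is a letter count; \<open>sum_history\<close> then applies to the indicator of
  P.\<close>

lemma prob_draws:
  fixes i :: 'q
  assumes a: "a > 0" and x0: "\<And>j. x0 $ j > 0"
  defines "\<alpha> \<equiv> x0 $ i / a" and "\<beta> \<equiv> (l1_norm x0 - x0 $ i) / a"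
  assumes \<beta>: "\<beta> > 0"
  shows "\<P>(\<omega> in M. P (draws a X n i \<omega>)) = (\<Sum>k\<le>n. beta_binomial \<alpha> \<beta> n k * of_bool (P k))"
proof -
  have "\<P>(\<omega> in M. P (draws a X n i \<omega>)) = prob (\<Union>w\<in>{w. length w = n \<and> P (count_list w i)}. history M a x0 X w)"
  proof (rule finite_measure_eq_AE)
    show "AE \<omega> in M. (\<omega> \<in> {\<omega> \<in> space M. P (draws a X n i \<omega>)}) =
       (\<omega> \<in> (\<Union>w\<in>{w. length w = n \<and> P (count_list w i)}. history M a x0 X w))"
      using AE_history[OF a x0 \<beta>[unfolded \<beta>_def], of n] AE_space
    proof eventually_elim
      case (elim \<omega>)
      then obtain w where w: "length w = n" "\<omega> \<in> history M a x0 X w" by auto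
      have "count_list w' i = draws a X n i \<omega>" if "length w' = n" "\<omega> \<in> history M a x0 X w'" for w'
        using draws_history[OF a that(2), of i] that(1) by simp
      with w elim(2) show ?case by auto
    qed
    show "(\<Union>w\<in>{w. length w = n \<and> P (count_list w i)}. history M a x0 X w) \<in> events"
      by (intro sets.finite_UN finite_subset[OF _ finite_words[of n]]) auto
  qed measurable
  also have "\<dots> = (\<Sum>w | length w = n \<and> P (count_list w i). prob (history M a x0 X w))"
    by (intro finite_measure_finite_Union finite_subset[OF _ finite_words[of n]]
        disjoint_family_on_mono[OF _ disjoint_history[OF a, where n = n]]) auto
  also have "\<dots> = (\<Sum>w | length w = n. prob (history M a x0 X w) * of_bool (P (count_list w i)))"
    by (intro sum.mono_neutral_cong_left finite_words) auto
  also have "\<dots> = (\<Sum>k\<le>n. beta_binomial \<alpha> \<beta> n k * of_bool (P k))"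
    by (rule sum_history[OF a x0 \<beta>[unfolded \<beta>_def], folded \<alpha>_def \<beta>_def])
  finally show ?thesis .
qed

end

section \<open>Lower bounds for the atoms\<close>

text \<open>By Euler's limit for the Gamma function, the atom at 0 times
  \<open>n powr \<alpha>\<close> is eventually at least half of
  \<open>Gamma (\<alpha> + \<beta>) / Gamma \<beta>\<close>; the finitely many earlier values are
  positive.\<close>

lemma beta_binomial_0_lower_bound:
  assumes \<alpha>: "\<alpha> > 0" and \<beta>: "\<beta> > 0"
  shows "\<exists>c>0. \<forall>n\<ge>1. c * real n powr (- \<alpha>) \<le> beta_binomial \<alpha> \<beta> n 0"
proof -
  define r where "r n = beta_binomial \<alpha> \<beta> n 0 * real n powr \<alpha>" for n
  let ?L = "Gamma (\<alpha> + \<beta>) / Gamma \<beta>"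
  have L: "?L > 0" using \<alpha> \<beta> by simp
  have "(\<lambda>n. Gamma_series (\<alpha> + \<beta>) n / Gamma_series \<beta> n) \<longlonglongrightarrow> ?L"
    using Gamma_real_pos[OF \<beta>] by (intro tendsto_divide Gamma_series_LIMSEQ) auto
  then have "eventually (\<lambda>n. Gamma_series (\<alpha> + \<beta>) n / Gamma_series \<beta> n > ?L / 2) sequentially"
    using L by (intro order_tendstoD) auto
  then have "eventually (\<lambda>n. r n \<ge> ?L / 2) sequentially"
    using eventually_ge_at_top[of 1]
  proof eventually_elim
    case (elim n)
    have "Gamma_series (\<alpha> + \<beta>) n / Gamma_series \<beta> n =
        (exp ((\<alpha> + \<beta>) * ln n) / exp (\<beta> * ln n)) * (pochhammer \<beta> (Suc n) / pochhammer (\<alpha> + \<beta>) (Suc n))"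
      by (simp add: Gamma_series_def)
    also have "exp ((\<alpha> + \<beta>) * ln n) / exp (\<beta> * ln n) = real n powr \<alpha>"
      using elim by (simp add: exp_diff[symmetric] powr_def algebra_simps)
    also have "pochhammer \<beta> (Suc n) / pochhammer (\<alpha> + \<beta>) (Suc n) = beta_binomial \<alpha> \<beta> (Suc n) 0"
      by (simp add: beta_binomial_def)
    \<comment> \<open>\<open>Gamma_series\<close> carries n + 1 factors and so yields the atom for
      \<open>Suc n\<close>; the extra factor \<open>(\<beta> + n) / (\<alpha> + \<beta> + n)\<close>
      is at most 1.\<close>
    also have "real n powr \<alpha> * beta_binomial \<alpha> \<beta> (Suc n) 0 \<le> real n powr \<alpha> * (1 * beta_binomial \<alpha> \<beta> n 0)"
      unfolding beta_binomial_Suc_0 using \<alpha> \<beta>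
      by (intro mult_left_mono mult_right_mono beta_binomial_nonneg) (auto simp: divide_simps add_pos_nonneg)
    finally show ?case
      using elim(1) by (simp add: r_def mult.commute)
  qed
  then obtain N where N: "\<And>n. n \<ge> N \<Longrightarrow> r n \<ge> ?L / 2"
    by (auto simp: eventually_sequentially)
  define c where "c = Min (insert (?L / 2) (r ` {1..<N}))"
  have "r n > 0" if "n \<ge> 1" for n
    using that \<alpha> \<beta> by (auto simp: r_def beta_binomial_def intro!: divide_pos_pos mult_pos_pos pochhammer_pos)
  then have "c > 0"
    using L by (auto simp: c_def)
  moreover have "c * real n powr (- \<alpha>) \<le> beta_binomial \<alpha> \<beta> n 0" if "n \<ge> 1" for n
  proof -
    have "c \<le> r n"
    proof (cases "n < N")
      case True
      then show ?thesis using that unfolding c_def by (intro Min_le) auto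
    next
      case False
      have "c \<le> ?L / 2" unfolding c_def by (intro Min_le) auto
      then show ?thesis using N[of n] False by simp
    qed
    then have "c * real n powr (- \<alpha>) \<le> r n * real n powr (- \<alpha>)"
      by (intro mult_right_mono) auto
    also have "\<dots> = beta_binomial \<alpha> \<beta> n 0"
      using that by (simp add: r_def powr_minus)
    finally show ?thesis .
  qed
  ultimately show ?thesis by blast
qed

lemma beta_binomial_atom_lower_bound:
  assumes \<alpha>: "\<alpha> > 0" and \<beta>: "\<beta> > 0"
  shows "\<exists>c>0. \<forall>n\<ge>1. \<exists>k\<le>n. c * real n powr (- Min {\<alpha>, \<beta>, 1}) \<le> beta_binomial \<alpha> \<beta> n k"
proof -
  consider "Min {\<alpha>, \<beta>, 1} = \<alpha>" | "Min {\<alpha>, \<beta>, 1} = \<beta>" | "Min {\<alpha>, \<beta>, 1} = 1"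
    using Min_in[of "{\<alpha>, \<beta>, 1}"] by auto
  then show ?thesis
  proof cases
    case 1
    then show ?thesis using beta_binomial_0_lower_bound[OF \<alpha> \<beta>] by (metis le0)
  next
    case 2
    \<comment> \<open>Exchanging the roles of drawing and not drawing the colour carries the atom at
      n to the atom at 0.\<close>
    have "beta_binomial \<alpha> \<beta> n n = beta_binomial \<beta> \<alpha> n 0" for n
      by (simp add: beta_binomial_def add.commute)
    with 2 show ?thesis using beta_binomial_0_lower_bound[OF \<beta> \<alpha>] by (metis order_refl)
  next
    case 3
    \<comment> \<open>Pigeonhole on n + 1 atoms of total mass 1; the constant 1 / 2 comes from n + 1
      \<le> 2 n.\<close>
    have "\<exists>k\<le>n. 1 / 2 * real n powr (- 1) \<le> beta_binomial \<alpha> \<beta> n k" if n: "n \<ge> 1" for n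
    proof (rule ccontr)
      assume none: "\<not> ?thesis"
      have "beta_binomial \<alpha> \<beta> n k < 1 / (2 * real n)" if "k \<le> n" for k
      proof -
        have "\<not> 1 / 2 * real n powr (- 1) \<le> beta_binomial \<alpha> \<beta> n k" using none that by blast
        then show ?thesis by (simp add: powr_minus_divide)
      qed
      then have "(\<Sum>k\<le>n. beta_binomial \<alpha> \<beta> n k) < (\<Sum>k\<le>n. 1 / (2 * real n))"
        by (intro sum_strict_mono) auto
      also have "\<dots> \<le> 1" using n by (simp add: field_simps)
      finally show False by (simp add: beta_binomial_sum[OF \<alpha> \<beta>])
    qed
    with 3 show ?thesis by (intro exI[of _ "1 / 2"]) auto
  qed
qed

subsection \<open>The beta distribution function\<close>

text \<open>The ratios x / (x + y) and y / (x + y) lie between 0 and 1, where z \<le> z powr p for p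
  \<le> 1, and they sum to 1.\<close>

lemma powr_add_le_add_powr:
  fixes x y p :: real
  assumes "0 \<le> x" "0 \<le> y" "p \<le> 1"
  shows "(x + y) powr p \<le> x powr p + y powr p"
proof (cases "x + y = 0")
  case False
  then have s: "x + y > 0" using assms by simp
  have *: "z / (x + y) \<le> z powr p / (x + y) powr p" if "0 \<le> z" "z \<le> x + y" for z
    using powr_mono'[of p 1 "z / (x + y)"] that assms s by (simp add: powr_divide)
  have "1 = x / (x + y) + y / (x + y)" using s by (simp add: add_divide_distrib[symmetric])
  also have "\<dots> \<le> (x powr p + y powr p) / (x + y) powr p"
    unfolding add_divide_distrib using assms by (intro add_mono *) auto
  finally show ?thesis using s by (simp add: field_simps)
qed (use assms in auto)

text \<open>One formula serves all real x: for negative x the interval is empty, and beyond 1 the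
  density is zero.\<close>

definition beta_cdf :: "real \<Rightarrow> real \<Rightarrow> real \<Rightarrow> real" where
  "beta_cdf \<alpha> \<beta> x = integral {0..x} (beta_density \<alpha> \<beta>)"

lemma Beta_real_pos: "\<alpha> > 0 \<Longrightarrow> \<beta> > 0 \<Longrightarrow> Beta \<alpha> \<beta> > (0 :: real)"
  by (simp add: Beta_def)

context
  fixes \<alpha> \<beta> :: real
  assumes \<alpha>: "\<alpha> > 0" and \<beta>: "\<beta> > 0"
begin

lemma beta_density_nonneg: "beta_density \<alpha> \<beta> t \<ge> 0"
  using Beta_real_pos[OF \<alpha> \<beta>] by (simp add: beta_density_def)

lemma has_integral_beta_density: "(beta_density \<alpha> \<beta> has_integral 1) {0..1}"
proof -
  have "((\<lambda>t. t powr (\<alpha> - 1) * (1 - t) powr (\<beta> - 1) / Beta \<alpha> \<beta>) has_integral Beta \<alpha> \<beta> / Beta \<alpha> \<beta>) {0..1}"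
    by (intro has_integral_divide has_integral_Beta_real \<alpha> \<beta>)
  \<comment> \<open>At 0 and 1 the two integrands agree because \<open>0 powr p\<close> is
    0.\<close>
  then show ?thesis
    using Beta_real_pos[OF \<alpha> \<beta>]
    by (subst has_integral_cong[where g = "\<lambda>t. t powr (\<alpha> - 1) * (1 - t) powr (\<beta> - 1) / Beta \<alpha> \<beta>"])
       (auto simp: beta_density_def)
qed

lemma integrable_beta_density: "beta_density \<alpha> \<beta> integrable_on {x..y}"
proof -
  have "(beta_density \<alpha> \<beta> has_integral 1) UNIV"
    by (rule has_integral_on_superset[OF has_integral_beta_density]) (auto simp: beta_density_def)
  then show ?thesis
    using integrable_on_subcbox[of "beta_density \<alpha> \<beta>" UNIV x y] by (auto simp: has_integral_integrable)
qed

lemma has_integral_beta_cdf: "(beta_density \<alpha> \<beta> has_integral beta_cdf \<alpha> \<beta> x) {..x}"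
proof -
  have "(beta_density \<alpha> \<beta> has_integral beta_cdf \<alpha> \<beta> x) {0..x}"
    unfolding beta_cdf_def by (rule integrable_integral[OF integrable_beta_density])
  moreover have "negligible {t \<in> {0..x} - {..x}. beta_density \<alpha> \<beta> t \<noteq> 0}"
    and "negligible {t \<in> {..x} - {0..x}. beta_density \<alpha> \<beta> t \<noteq> 0}"
    by (auto intro!: negligible_subset[OF negligible_empty] simp: beta_density_def)
  ultimately show ?thesis
    using has_integral_spike_set_eq[of "{0..x}" "{..x}" "beta_density \<alpha> \<beta>"] by simp
qed

text \<open>Transfers statements proved on the unit interval, such as the Hoelder bound, to all real
  arguments.\<close>

lemma beta_cdf_clamp: "beta_cdf \<alpha> \<beta> x = beta_cdf \<alpha> \<beta> (max 0 (min 1 x))"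
proof -
  consider "x < 0" | "0 \<le> x" "x \<le> 1" | "x > 1" by linarith
  then show ?thesis
  proof cases
    case 3
    have "(beta_density \<alpha> \<beta> has_integral 1) {0..x}"
      by (rule has_integral_on_superset[OF has_integral_beta_density])
         (use 3 in \<open>auto simp: beta_density_def\<close>)
    with has_integral_beta_density 3 show ?thesis
      by (simp add: beta_cdf_def integral_unique)
  qed (auto simp: beta_cdf_def)
qed

lemma beta_cdf_0: "x \<le> 0 \<Longrightarrow> beta_cdf \<alpha> \<beta> x = 0"
  by (subst beta_cdf_clamp) (simp add: beta_cdf_def)

lemma beta_cdf_1: "x \<ge> 1 \<Longrightarrow> beta_cdf \<alpha> \<beta> x = 1"
  using has_integral_beta_density
  by (subst beta_cdf_clamp) (simp add: beta_cdf_def integral_unique)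

lemma continuous_on_beta_cdf: "continuous_on {0..1} (beta_cdf \<alpha> \<beta>)"
  unfolding beta_cdf_def[abs_def]
  by (rule indefinite_integral_continuous_1[OF integrable_beta_density])

text \<open>Written as density times logarithmic derivative, so that a bound on the density yields
  one on its slope.\<close>

lemma beta_density_has_real_derivative:
  assumes "0 < t" "t < 1"
  shows "(beta_density \<alpha> \<beta> has_real_derivative
    beta_density \<alpha> \<beta> t * ((\<alpha> - 1) / t - (\<beta> - 1) / (1 - t))) (at t)"
proof -
  define u v where "u = t powr (\<alpha> - 1)" and "v = (1 - t) powr (\<beta> - 1)"
  have *: "(x * (u / y) * v + - z * (v / w) * u) / b = u * v / b * (x / y - z / w)" for x y z w b
    by (simp add: algebra_simps add_divide_distrib diff_divide_distrib)
  have "((\<lambda>t. t powr (\<alpha> - 1)) has_real_derivative (\<alpha> - 1) * (u / t)) (at t)"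
    using has_real_derivative_powr[OF assms(1), of "\<alpha> - 1"] assms powr_diff[of t "\<alpha> - 1" 1]
    by (simp add: u_def)
  moreover have "((\<lambda>t. (1 - t) powr (\<beta> - 1)) has_real_derivative - (\<beta> - 1) * (v / (1 - t))) (at t)"
    using DERIV_fun_powr[of "\<lambda>t. 1 - t" "- 1" t "\<beta> - 1"] assms powr_diff[of "1 - t" "\<beta> - 1" 1]
    by (auto intro!: derivative_eq_intros simp: v_def left_diff_distrib diff_divide_distrib)
  ultimately have "((\<lambda>t. t powr (\<alpha> - 1) * (1 - t) powr (\<beta> - 1) / Beta \<alpha> \<beta>) has_real_derivative
      ((\<alpha> - 1) * (u / t) * v + - (\<beta> - 1) * (v / (1 - t)) * u) / Beta \<alpha> \<beta>) (at t)"
    unfolding u_def v_def by (intro DERIV_cdivide DERIV_mult)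
  also have "((\<alpha> - 1) * (u / t) * v + - (\<beta> - 1) * (v / (1 - t)) * u) / Beta \<alpha> \<beta> =
      beta_density \<alpha> \<beta> t * ((\<alpha> - 1) / t - (\<beta> - 1) / (1 - t))"
    using assms *[of "\<alpha> - 1" t "\<beta> - 1" "1 - t" "Beta \<alpha> \<beta>"]
    by (simp add: beta_density_def u_def[symmetric] v_def[symmetric])
  finally have "((\<lambda>t. t powr (\<alpha> - 1) * (1 - t) powr (\<beta> - 1) / Beta \<alpha> \<beta>) has_real_derivative
    beta_density \<alpha> \<beta> t * ((\<alpha> - 1) / t - (\<beta> - 1) / (1 - t))) (at t)" .
  moreover have "eventually (\<lambda>t. t \<in> {0<..<1}) (nhds t)"
    using assms by (intro eventually_nhds_in_open) auto
  then have "eventually (\<lambda>t. beta_density \<alpha> \<beta> t = t powr (\<alpha> - 1) * (1 - t) powr (\<beta> - 1) / Beta \<alpha> \<beta>) (nhds t)"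
    by eventually_elim (simp add: beta_density_def)
  ultimately show ?thesis
    by (subst DERIV_cong_ev[OF refl _ refl])
qed

lemma beta_cdf_has_real_derivative:
  assumes "0 < t" "t < 1"
  shows "(beta_cdf \<alpha> \<beta> has_real_derivative beta_density \<alpha> \<beta> t) (at t)"
proof -
  have "continuous (at t) (beta_density \<alpha> \<beta>)"
    using beta_density_has_real_derivative[OF assms] DERIV_isCont by blast
  then have "((\<lambda>u. integral {0..u} (beta_density \<alpha> \<beta>)) has_vector_derivative beta_density \<alpha> \<beta> t)
      (at t within ({0..1} - {}))"
    using assms
    by (intro integral_has_vector_derivative_continuous_at integrable_beta_density)
       (auto intro: continuous_at_imp_continuous_at_within)
  then show ?thesis
    using assms at_within_interior[of t "{0..1}"]
    by (simp add: beta_cdf_def[abs_def] has_real_derivative_iff_has_vector_derivative)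
qed

lemma prob_beta_le:
  assumes "prob_space N" and W: "distributed N lborel W (beta_density \<alpha> \<beta>)"
  shows "\<P>(\<omega> in N. W \<omega> \<le> x) = beta_cdf \<alpha> \<beta> x"
proof -
  have "beta_cdf \<alpha> \<beta> x \<ge> 0"
    by (rule has_integral_nonneg[OF has_integral_beta_cdf beta_density_nonneg])
  moreover have "emeasure N (W -` {..x} \<inter> space N) = (\<integral>\<^sup>+t. ennreal (beta_density \<alpha> \<beta> t) * indicator {..x} t \<partial>lborel)"
    by (rule distributed_emeasure[OF W]) simp
  then have "emeasure N (W -` {..x} \<inter> space N) = ennreal (beta_cdf \<alpha> \<beta> x)"
    using nn_integral_has_integral_lebesgue'[OF beta_density_nonneg has_integral_beta_cdf] by simp
  moreover have "W -` {..x} \<inter> space N = {\<omega> \<in> space N. W \<omega> \<le> x}" by auto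
  ultimately show ?thesis by (simp add: measure_def)
qed

end

section \<open>Integral representation of the beta-binomial distribution function\<close>

lemma has_integral_power_mult_power:
  "((\<lambda>t :: real. t ^ i * (1 - t) ^ j) has_integral fact i * fact j / fact (Suc (i + j))) {0..1}"
\<comment> \<open>The end points are discarded: \<open>0 powr 0\<close> is 0 while
  \<open>0 ^ 0\<close> is 1.\<close>
proof (rule has_integral_spike_finite[of "{0, 1}"])
  have "((\<lambda>t :: real. t powr (real (Suc i) - 1) * (1 - t) powr (real (Suc j) - 1)) has_integral
      Beta (real (Suc i)) (real (Suc j))) {0..1}"
    by (rule has_integral_Beta_real) auto
  moreover have "real (Suc i) + real (Suc j) = 1 + real (Suc (i + j))" by simp
  then have "Beta (real (Suc i)) (real (Suc j)) = fact i * fact j / fact (Suc (i + j))"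
    unfolding Beta_def using Gamma_fact[of i, where 'a = real] Gamma_fact[of j, where 'a = real]
      Gamma_fact[of "Suc (i + j)", where 'a = real]
    by (simp only: of_nat_Suc)
  ultimately show "((\<lambda>t :: real. t powr (real (Suc i) - 1) * (1 - t) powr (real (Suc j) - 1)) has_integral
      fact i * fact j / fact (Suc (i + j))) {0..1}" by simp
qed (auto simp: powr_realpow)

text \<open>Differentiating the binomial distribution function in the success probability
  telescopes; what remains is minus the density of the (k+1)-st order statistic of n uniform
  variables.\<close>

lemma binomial_cdf_has_real_derivative:
  fixes w :: real
  assumes "k < n"
  shows "((\<lambda>w. \<Sum>j\<le>k. real (n choose j) * w ^ j * (1 - w) ^ (n - j)) has_real_derivative
    - (real (n - k) * real (n choose k) * w ^ k * (1 - w) ^ (n - Suc k))) (at w)"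
  using assms
proof (induction k)
  case 0
  then show ?case by (auto intro!: derivative_eq_intros)
next
  case (Suc k)
  \<comment> \<open>With this identity the positive part of the new term's derivative cancels the
    derivative of the earlier sum.\<close>
  have absorb: "real (n - k) * real (n choose k) = real (Suc k) * real (n choose Suc k)"
    unfolding of_nat_mult[symmetric] binomial_absorb_comp binomial_absorption ..
  have "((\<lambda>w. real (n choose Suc k) * w ^ Suc k * (1 - w) ^ (n - Suc k)) has_real_derivative
      real (Suc k) * real (n choose Suc k) * w ^ k * (1 - w) ^ (n - Suc k)
      - real (n - Suc k) * real (n choose Suc k) * w ^ Suc k * (1 - w) ^ (n - Suc (Suc k))) (at w)"
  proof -
    have "((\<lambda>w. w ^ Suc k) has_real_derivative real (Suc k) * w ^ k) (at w)"
      using DERIV_pow[of "Suc k" w] by simp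
    moreover have "((\<lambda>w. (1 - w) ^ (n - Suc k)) has_real_derivative
        - real (n - Suc k) * (1 - w) ^ (n - Suc (Suc k))) (at w)"
      by (auto intro!: derivative_eq_intros)
    ultimately have "((\<lambda>w. real (n choose Suc k) * w ^ Suc k * (1 - w) ^ (n - Suc k)) has_real_derivative
        real (n choose Suc k) * (real (Suc k) * w ^ k) * (1 - w) ^ (n - Suc k) +
        - real (n - Suc k) * (1 - w) ^ (n - Suc (Suc k)) * (real (n choose Suc k) * w ^ Suc k)) (at w)"
      by (intro DERIV_mult DERIV_cmult)
    then show ?thesis
      by (simp add: mult_ac)
  qed
  from DERIV_add[OF Suc.IH this] Suc.prems show ?case
    unfolding sum.atMost_Suc absorb by simp
qed

context
  fixes \<alpha> \<beta> :: real
  assumes \<alpha>: "\<alpha> > 0" and \<beta>: "\<beta> > 0"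
begin

text \<open>Mixture form: given a beta variable w, the count is binomial with success probability w.
  The functional equation of Gamma turns the Beta function at shifted parameters into rising
  factorials.\<close>

lemma has_integral_beta_binomial:
  assumes "j \<le> n"
  shows "((\<lambda>w. real (n choose j) * w ^ j * (1 - w) ^ (n - j) * beta_density \<alpha> \<beta> w)
    has_integral beta_binomial \<alpha> \<beta> n j) {0..1}"
proof -
  let ?c = "real (n choose j) / Beta \<alpha> \<beta>"
  have Gamma: "Gamma (z + real m) = pochhammer z m * Gamma z" if "z > 0" for z m
  proof -
    have "z \<notin> \<int>\<^sub>\<le>\<^sub>0" using nonpos_Ints_nonpos[of z] that by auto
    then show ?thesis
      using pochhammer_Gamma[of z m] Gamma_real_pos[OF that] by simp
  qed
  have "\<alpha> + real j + (\<beta> + real (n - j)) = \<alpha> + \<beta> + real n" using assms by simp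
  then have "Beta (\<alpha> + real j) (\<beta> + real (n - j)) = (pochhammer \<alpha> j * Gamma \<alpha>) *
      (pochhammer \<beta> (n - j) * Gamma \<beta>) / (pochhammer (\<alpha> + \<beta>) n * Gamma (\<alpha> + \<beta>))"
    unfolding Beta_def using \<alpha> \<beta> by (simp only: Gamma add_pos_pos)
  moreover have "Gamma (\<alpha> + \<beta>) \<noteq> 0" "Gamma \<alpha> \<noteq> 0" "Gamma \<beta> \<noteq> 0"
    using Gamma_real_pos[OF \<alpha>] Gamma_real_pos[OF \<beta>] Gamma_real_pos[OF add_pos_pos[OF \<alpha> \<beta>]] by auto
  ultimately have "?c * Beta (\<alpha> + real j) (\<beta> + real (n - j)) = beta_binomial \<alpha> \<beta> n j"
    by (simp add: Beta_def beta_binomial_def)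
  moreover have "((\<lambda>w. ?c * (w powr (\<alpha> + real j - 1) * (1 - w) powr (\<beta> + real (n - j) - 1)))
      has_integral ?c * Beta (\<alpha> + real j) (\<beta> + real (n - j))) {0..1}"
    using \<alpha> \<beta> by (intro has_integral_mult_right has_integral_Beta_real) auto
  moreover have "?c * (w powr (\<alpha> + real j - 1) * (1 - w) powr (\<beta> + real (n - j) - 1)) =
      real (n choose j) * w ^ j * (1 - w) ^ (n - j) * beta_density \<alpha> \<beta> w" if "w \<in> {0..1}" for w
  proof (cases "0 < w \<and> w < 1")
    case True
    have "w powr (\<alpha> + real j - 1) = w powr (\<alpha> - 1) * w ^ j"
      "(1 - w) powr (\<beta> + real (n - j) - 1) = (1 - w) powr (\<beta> - 1) * (1 - w) ^ (n - j)"
      using True powr_add[of w "\<alpha> - 1" "real j"] powr_add[of "1 - w" "\<beta> - 1" "real (n - j)"]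
      by (simp_all add: powr_realpow algebra_simps)
    with True show ?thesis by (simp add: beta_density_def)
  next
    case False
    with that have "w = 0 \<or> w = 1" by auto
    then show ?thesis by (auto simp: beta_density_def)
  qed
  ultimately show ?thesis
    by (metis (no_types, lifting) has_integral_cong)
qed

text \<open>This is \<open>P(Y \<le> k) = E G(U)\<close> for \<open>U\<close> the \<open>(k+1)\<close>-st order statistic of \<open>n\<close> uniform
  variables, obtained by integrating by parts.\<close>

lemma has_integral_beta_binomial_cdf:
  assumes "k < n"
  shows "((\<lambda>w. real (n - k) * real (n choose k) * w ^ k * (1 - w) ^ (n - Suc k) * beta_cdf \<alpha> \<beta> w)
    has_integral (\<Sum>j\<le>k. beta_binomial \<alpha> \<beta> n j)) {0..1}"
proof -
  let ?Q = "\<lambda>w :: real. \<Sum>j\<le>k. real (n choose j) * w ^ j * (1 - w) ^ (n - j)"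
  let ?b = "\<lambda>w :: real. real (n - k) * real (n choose k) * w ^ k * (1 - w) ^ (n - Suc k)"
  let ?g = "beta_density \<alpha> \<beta>" and ?G = "beta_cdf \<alpha> \<beta>"
  have "((\<lambda>w. \<Sum>j\<le>k. real (n choose j) * w ^ j * (1 - w) ^ (n - j) * ?g w)
      has_integral (\<Sum>j\<le>k. beta_binomial \<alpha> \<beta> n j)) {0..1}"
    by (intro has_integral_sum has_integral_beta_binomial) (use assms in auto)
  then have Qg: "((\<lambda>w. ?Q w * ?g w) has_integral (\<Sum>j\<le>k. beta_binomial \<alpha> \<beta> n j)) {0..1}"
    by (simp add: sum_distrib_right)
  \<comment> \<open>Product rule for \<open>?Q\<close> and \<open>?G\<close>. Both boundary terms
    vanish: \<open>?Q 1\<close> is 0 because k < n, and \<open>?G 0\<close> is 0. The interior form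
    of the fundamental theorem is used because the density may blow up at the end points.\<close>
  have "((\<lambda>w. - ?b w * ?G w + ?g w * ?Q w) has_integral (?Q 1 * ?G 1 - ?Q 0 * ?G 0)) {0..1}"
  proof (rule fundamental_theorem_of_calculus_interior)
    show "continuous_on {0..1} (\<lambda>w. ?Q w * ?G w)"
      by (intro continuous_intros continuous_on_beta_cdf \<alpha> \<beta>)
    show "((\<lambda>w. ?Q w * ?G w) has_vector_derivative - ?b w * ?G w + ?g w * ?Q w) (at w)"
      if "w \<in> {0<..<1}" for w
      unfolding has_real_derivative_iff_has_vector_derivative[symmetric]
      using that
      by (intro DERIV_mult binomial_cdf_has_real_derivative assms beta_cdf_has_real_derivative \<alpha> \<beta>) auto
  qed simp
  moreover have "?Q 1 = 0"
    using assms by (intro sum.neutral) auto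
  ultimately have "((\<lambda>w. - ?b w * ?G w + ?g w * ?Q w) has_integral 0) {0..1}"
    using beta_cdf_0[OF \<alpha> \<beta>, of 0] by simp
  from has_integral_diff[OF Qg this] show ?thesis
    by (simp add: mult.commute[of "?g _"])
qed

end

text \<open>Mass, mean and variance of Beta (k + 1, n - k): the raw moments of order 0, 1, 2 come
  from one factorial integral and are then centred at m.\<close>

lemma order_statistic_moments:
  fixes k n :: nat
  assumes "k < n"
  defines "m \<equiv> real (Suc k) / real (Suc n)"
  defines "b \<equiv> (\<lambda>w :: real. real (n - k) * real (n choose k) * w ^ k * (1 - w) ^ (n - Suc k))"
  shows "(b has_integral 1) {0..1}"
    and "((\<lambda>w. b w * (w - m)) has_integral 0) {0..1}"
    and "((\<lambda>w. b w * (w - m)\<^sup>2) has_integral m * (1 - m) / (n + 2)) {0..1}"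
proof -
  \<comment> \<open>Writing n = k + l + 1 removes the truncated subtractions.\<close>
  obtain l where n: "n = Suc (k + l)" using assms(1) less_iff_Suc_add by auto
  let ?c = "fact n / (fact k * fact l) :: real"
  have nk: "n - k = Suc l" "n - Suc k = l" using n by auto
  have "real (n choose k) = fact n / (fact k * fact (Suc l))"
    using binomial_fact[of k n, where 'a = real] assms(1) by (simp add: nk del: fact_Suc)
  then have "real (n - k) * real (n choose k) = ?c"
    unfolding nk by (simp add: divide_simps mult_ac del: of_nat_Suc)
  then have b: "b w = ?c * (w ^ k * (1 - w) ^ l)" for w
    by (simp add: b_def nk(2))
  have moment: "((\<lambda>w. b w * w ^ r) has_integral ?c * (fact (k + r) * fact l / fact (n + r))) {0..1}" for r
    using has_integral_mult_right[OF has_integral_power_mult_power[of "k + r" l], of ?c]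
    by (simp add: b power_add mult_ac n add_ac del: fact_Suc)
  have 0: "(b has_integral 1) {0..1}"
    using moment[of 0] by simp
  have 1: "((\<lambda>w. b w * w) has_integral m) {0..1}"
    using moment[of 1] by (simp add: m_def n del: of_nat_Suc)
  have 2: "((\<lambda>w. b w * w\<^sup>2) has_integral m * (real (k + 2) / real (n + 2))) {0..1}"
    using moment[of 2] by (simp add: m_def n numeral_2_eq_2 mult_ac del: of_nat_Suc)
  show "(b has_integral 1) {0..1}" by (rule 0)
  have "((\<lambda>w. b w * w - m * b w) has_integral m - m * 1) {0..1}"
    by (intro has_integral_diff has_integral_mult_right 0 1)
  then show "((\<lambda>w. b w * (w - m)) has_integral 0) {0..1}"
    by (simp add: algebra_simps)
  have "((\<lambda>w. b w * w\<^sup>2 - 2 * m * (b w * w) + m\<^sup>2 * b w) has_integral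
      m * (real (k + 2) / real (n + 2)) - 2 * m * m + m\<^sup>2 * 1) {0..1}"
    by (intro has_integral_diff has_integral_add has_integral_mult_right 0 1 2)
  also have "(\<lambda>w. b w * w\<^sup>2 - 2 * m * (b w * w) + m\<^sup>2 * b w) = (\<lambda>w. b w * (w - m)\<^sup>2)"
    by (simp add: fun_eq_iff power2_eq_square algebra_simps)
  also have "m * (real (k + 2) / real (n + 2)) - 2 * m * m + m\<^sup>2 * 1 =
      m * (real (k + 2) / real (n + 2) - m)"
    by (simp add: power2_eq_square algebra_simps)
  also have "real (k + 2) / real (n + 2) - m = (1 - m) / (n + 2)"
    unfolding m_def by (simp add: field_simps)
  finally show "((\<lambda>w. b w * (w - m)\<^sup>2) has_integral m * (1 - m) / (n + 2)) {0..1}" by simp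
qed

subsection \<open>Bounds on the distance\<close>

text \<open>The frequency of draws is the case \<open>s = t = 0\<close>, the proportion in the urn the case \<open>s = \<alpha>\<close>,
  \<open>t = \<alpha> + \<beta>\<close>.\<close>

definition shifted_cdf :: "real \<Rightarrow> real \<Rightarrow> real \<Rightarrow> real \<Rightarrow> nat \<Rightarrow> real \<Rightarrow> real" where
  "shifted_cdf \<alpha> \<beta> s t n x =
    (\<Sum>k\<le>n. beta_binomial \<alpha> \<beta> n k * of_bool ((real k + s) / (real n + t) \<le> x))"

section \<open>Regularity of the beta distribution function\<close>

locale beta_exponent =
  fixes \<alpha> \<beta> \<rho> :: real
  assumes \<rho>: "0 < \<rho>" "\<rho> \<le> 1" "\<rho> \<le> \<alpha>" "\<rho> \<le> \<beta>"
begin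

lemma \<alpha>: "\<alpha> > 0" and \<beta>: "\<beta> > 0"
  using \<rho> by auto

abbreviation "g \<equiv> beta_density \<alpha> \<beta>"
abbreviation "G \<equiv> beta_cdf \<alpha> \<beta>"
abbreviation "B \<equiv> Beta \<alpha> \<beta>"

lemmas B_pos = Beta_real_pos[OF \<alpha> \<beta>]

text \<open>On the unit interval lowering an exponent enlarges the power, so \<alpha> - 1 and
  \<beta> - 1 may both be lowered to \<rho> - 1.\<close>

lemma beta_density_le:
  assumes "0 < t" "t < 1"
  shows "g t \<le> (t * (1 - t)) powr (\<rho> - 1) / B"
proof -
  have "t powr (\<alpha> - 1) * (1 - t) powr (\<beta> - 1) \<le> t powr (\<rho> - 1) * (1 - t) powr (\<rho> - 1)"
    using assms \<rho> by (intro mult_mono powr_mono') auto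
  then show ?thesis
    using assms B_pos by (simp add: beta_density_def powr_mult divide_right_mono)
qed

text \<open>One of t and 1 - t is at least 1 / 2, and its power with exponent \<rho> - 1 \<ge> -1 is
  at most 2. The sum has an explicit antiderivative.\<close>

lemma powr_mult_le_add:
  assumes "0 < t" "t < 1"
  shows "(t * (1 - t)) powr (\<rho> - 1) \<le> 2 * (t powr (\<rho> - 1) + (1 - t) powr (\<rho> - 1))"
proof -
  have *: "s powr (\<rho> - 1) \<le> 2" if "1 / 2 \<le> s" for s
  proof -
    have "s powr (\<rho> - 1) \<le> (1 / 2) powr (\<rho> - 1)"
      using that \<rho> by (intro powr_mono2') auto
    also have "\<dots> \<le> (1 / 2) powr (- 1)"
      using \<rho> by (intro powr_mono') auto
    finally show ?thesis by (simp add: powr_minus_divide)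
  qed
  have "t powr (\<rho> - 1) * (1 - t) powr (\<rho> - 1) \<le> 2 * (t powr (\<rho> - 1) + (1 - t) powr (\<rho> - 1))"
  proof (cases "t \<le> 1 / 2")
    case True
    then have "t powr (\<rho> - 1) * (1 - t) powr (\<rho> - 1) \<le> t powr (\<rho> - 1) * 2"
      by (intro mult_left_mono *) auto
    also have "\<dots> \<le> 2 * (t powr (\<rho> - 1) + (1 - t) powr (\<rho> - 1))" by simp
    finally show ?thesis .
  next
    case False
    then have "t powr (\<rho> - 1) * (1 - t) powr (\<rho> - 1) \<le> 2 * (1 - t) powr (\<rho> - 1)"
      by (intro mult_right_mono *) auto
    also have "\<dots> \<le> 2 * (t powr (\<rho> - 1) + (1 - t) powr (\<rho> - 1))" by simp
    finally show ?thesis .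
  qed
  then show ?thesis using assms by (simp add: powr_mult)
qed

text \<open>The Hoelder constant: 2 / (\<rho> B) from integrating the density bound, doubled because
  both end points contribute.\<close>

definition "H = 4 / (\<rho> * B)"

lemma H_pos: "H > 0"
  using \<rho> B_pos by (simp add: H_def)

text \<open>An explicit antiderivative of the density bound minus \<open>G\<close> is increasing, so
  it dominates the increments of \<open>G\<close>; subadditivity of powers bounds its own
  increments.\<close>

lemma beta_cdf_Hoelder_unit:
  assumes "0 \<le> x" "x \<le> y" "y \<le> 1"
  shows "\<bar>G y - G x\<bar> \<le> H * (y - x) powr \<rho>"
proof -
  let ?c = "2 / (\<rho> * B)"
  let ?F = "\<lambda>t. ?c * (t powr \<rho> - (1 - t) powr \<rho>) - G t"
  have cont: "continuous_on {x..y} G"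
    by (rule continuous_on_subset[OF continuous_on_beta_cdf[OF \<alpha> \<beta>]]) (use assms in auto)
  have "?F x \<le> ?F y"
  proof (rule DERIV_nonneg_imp_increasing_open[OF \<open>x \<le> y\<close>])
    fix t assume "x < t" "t < y"
    with assms have t: "0 < t" "t < 1" by auto
    have "(?F has_real_derivative
        ?c * (\<rho> * t powr (\<rho> - 1) + \<rho> * (1 - t) powr (\<rho> - 1)) - g t) (at t)"
      using t \<rho>(1) B_pos
      by (auto intro!: derivative_eq_intros beta_cdf_has_real_derivative[OF \<alpha> \<beta>] simp del: divide_const_simps)
    moreover have "g t \<le> ?c * (\<rho> * t powr (\<rho> - 1) + \<rho> * (1 - t) powr (\<rho> - 1))"
    proof -
      have "g t \<le> (2 * (t powr (\<rho> - 1) + (1 - t) powr (\<rho> - 1))) / B"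
        using beta_density_le[OF t] divide_right_mono[OF powr_mult_le_add[OF t], of B] B_pos by simp
      also have "\<dots> = ?c * (\<rho> * t powr (\<rho> - 1) + \<rho> * (1 - t) powr (\<rho> - 1))"
      proof -
        have "\<rho> \<noteq> 0" "B \<noteq> 0" using \<rho> B_pos by auto
        then show ?thesis by (simp add: field_simps)
      qed
      finally show ?thesis .
    qed
    ultimately show "\<exists>z. (?F has_real_derivative z) (at t) \<and> 0 \<le> z" by fastforce
  next
    show "continuous_on {x..y} ?F"
      using assms \<rho> by (intro continuous_on_diff continuous_on_mult continuous_on_const
          continuous_on_powr' continuous_on_id cont) auto
  qed
  moreover have "y powr \<rho> \<le> x powr \<rho> + (y - x) powr \<rho>"
    using powr_add_le_add_powr[of x "y - x" \<rho>] assms \<rho> by simp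
  moreover have "(1 - x) powr \<rho> \<le> (1 - y) powr \<rho> + (y - x) powr \<rho>"
    using powr_add_le_add_powr[of "1 - y" "y - x" \<rho>] assms \<rho> by simp
  ultimately have "G y - G x \<le> ?c * (2 * (y - x) powr \<rho>)"
  proof -
    assume 1: "?F x \<le> ?F y" and 2: "y powr \<rho> \<le> x powr \<rho> + (y - x) powr \<rho>"
      "(1 - x) powr \<rho> \<le> (1 - y) powr \<rho> + (y - x) powr \<rho>"
    have "G y - G x \<le> ?c * (y powr \<rho> - (1 - y) powr \<rho> - (x powr \<rho> - (1 - x) powr \<rho>))"
      using 1 unfolding right_diff_distrib by linarith
    also have "\<dots> \<le> ?c * (2 * (y - x) powr \<rho>)"
      using 2 \<rho> B_pos by (intro mult_left_mono) auto
    finally show ?thesis .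
  qed
  moreover have "G x \<le> G y"
  proof (rule DERIV_nonneg_imp_increasing_open[OF \<open>x \<le> y\<close>])
    fix t assume "x < t" "t < y"
    then show "\<exists>z. (G has_real_derivative z) (at t) \<and> 0 \<le> z"
      using assms beta_cdf_has_real_derivative[OF \<alpha> \<beta>, of t] beta_density_nonneg[OF \<alpha> \<beta>, of t] by auto
  qed (rule cont)
  ultimately show ?thesis by (simp add: H_def)
qed

text \<open>Clamping both arguments to the unit interval keeps the values of \<open>G\<close> and
  does not increase the distance.\<close>

lemma beta_cdf_Hoelder: "\<bar>G x - G y\<bar> \<le> H * \<bar>x - y\<bar> powr \<rho>"
proof (induction x y rule: linorder_wlog)
  case (le x y)
  let ?c = "\<lambda>x :: real. max 0 (min 1 x)"
  have "\<bar>G x - G y\<bar> = \<bar>G (?c y) - G (?c x)\<bar>"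
    using beta_cdf_clamp[OF \<alpha> \<beta>, of x] beta_cdf_clamp[OF \<alpha> \<beta>, of y] by (metis abs_minus_commute)
  also have "\<dots> \<le> H * (?c y - ?c x) powr \<rho>"
    using le by (intro beta_cdf_Hoelder_unit) auto
  also have "\<dots> \<le> H * \<bar>x - y\<bar> powr \<rho>"
    using le \<rho> H_pos by (intro mult_left_mono powr_mono2) auto
  finally show ?case .
qed (simp add: abs_minus_commute)

text \<open>Controls the second derivative of \<open>G\<close> near m; the factor 16 = (1 / 4) powr
  (-2) pays for replacing t (1 - t) by m (1 - m) / 4.\<close>

definition "D = (\<bar>\<alpha> - 1\<bar> + \<bar>\<beta> - 1\<bar>) / B * 16"

lemma D_nonneg: "D \<ge> 0"
  using B_pos by (simp add: D_def)

text \<open>As m (1 - m) is at most m and at most 1 - m, moving by half of it keeps t \<ge> m / 2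
  and 1 - t \<ge> (1 - m) / 2, away from both singularities.\<close>

lemma deriv_beta_density_le:
  assumes m: "0 < m" "m < 1" and t: "\<bar>t - m\<bar> \<le> m * (1 - m) / 2"
  shows "0 < t" "t < 1"
    and "\<bar>g t * ((\<alpha> - 1) / t - (\<beta> - 1) / (1 - t))\<bar> \<le> D * (m * (1 - m)) powr (\<rho> - 2)"
proof -
  let ?d = "m * (1 - m)"
  have d: "?d > 0" "?d \<le> m" "?d \<le> 1 - m"
    using m mult_left_mono[of "1 - m" 1 m] mult_right_mono[of m 1 "1 - m"] by auto
  have t': "m / 2 \<le> t" "(1 - m) / 2 \<le> 1 - t"
  proof -
    have "t - m \<le> ?d / 2" "m - t \<le> ?d / 2" using t by linarith+
    moreover have "?d / 2 \<le> m / 2" "?d / 2 \<le> (1 - m) / 2" using d by simp_all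
    ultimately show "m / 2 \<le> t" "(1 - m) / 2 \<le> 1 - t" by argo+
  qed
  show t01: "0 < t" "t < 1"
    using t' m by auto
  have "?d / 4 = m / 2 * ((1 - m) / 2)" by simp
  also have "\<dots> \<le> t * (1 - t)"
    using t' m t01 by (intro mult_mono) auto
  finally have le: "?d / 4 \<le> t * (1 - t)" .
  have "\<bar>(\<alpha> - 1) / t - (\<beta> - 1) / (1 - t)\<bar> \<le> \<bar>\<alpha> - 1\<bar> / t + \<bar>\<beta> - 1\<bar> / (1 - t)"
    using t01 by (auto simp: abs_divide intro!: order_trans[OF abs_triangle_ineq4])
  also have "\<dots> \<le> \<bar>\<alpha> - 1\<bar> / (t * (1 - t)) + \<bar>\<beta> - 1\<bar> / (t * (1 - t))"
    using t01 by (intro add_mono divide_left_mono) auto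
  finally have "\<bar>g t * ((\<alpha> - 1) / t - (\<beta> - 1) / (1 - t))\<bar> \<le>
      ((t * (1 - t)) powr (\<rho> - 1) / B) * ((\<bar>\<alpha> - 1\<bar> + \<bar>\<beta> - 1\<bar>) / (t * (1 - t)))"
    unfolding abs_mult add_divide_distrib[symmetric]
    using beta_density_le[OF t01] beta_density_nonneg[OF \<alpha> \<beta>, of t] B_pos
    by (intro mult_mono) auto
  also have "\<dots> = (\<bar>\<alpha> - 1\<bar> + \<bar>\<beta> - 1\<bar>) / B * (t * (1 - t)) powr (\<rho> - 2)"
  proof -
    have "(t * (1 - t)) powr (\<rho> - 2) = (t * (1 - t)) powr (\<rho> - 1 - 1)" by simp
    also have "\<dots> = (t * (1 - t)) powr (\<rho> - 1) / (t * (1 - t))"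
      using t01 by (subst powr_diff) auto
    finally show ?thesis by simp
  qed
  also have "\<dots> \<le> (\<bar>\<alpha> - 1\<bar> + \<bar>\<beta> - 1\<bar>) / B * (16 * ?d powr (\<rho> - 2))"
  proof (intro mult_left_mono)
    have "(t * (1 - t)) powr (\<rho> - 2) \<le> (?d / 4) powr (\<rho> - 2)"
      using le d \<rho> by (intro powr_mono2') auto
    also have "\<dots> = (1 / 4) powr (\<rho> - 2) * ?d powr (\<rho> - 2)"
      using powr_mult[of "1 / 4" ?d "\<rho> - 2"] d by simp
    also have "\<dots> \<le> (1 / 4) powr (- 2) * ?d powr (\<rho> - 2)"
      using \<rho> by (intro mult_right_mono powr_mono') auto
    also have "(1 / 4) powr (- 2) = (16 :: real)" by (simp add: powr_minus_divide power2_eq_square)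
    finally show "(t * (1 - t)) powr (\<rho> - 2) \<le> 16 * ?d powr (\<rho> - 2)" .
  qed (use B_pos in auto)
  finally show "\<bar>g t * ((\<alpha> - 1) / t - (\<beta> - 1) / (1 - t))\<bar> \<le> D * ?d powr (\<rho> - 2)"
    by (simp only: D_def mult.assoc)
qed

text \<open>D serves arguments near m, the other two summands serve distant ones.\<close>

definition "K = D + 4 * H + 2 / B"

lemma K_pos: "K > 0"
  using D_nonneg H_pos B_pos by (simp add: K_def add_pos_pos add_nonneg_pos)

text \<open>Near m this is a Taylor bound from two mean value estimates, first for \<open>g\<close>
  and then for \<open>G\<close> minus its linear part. Far from m the increment of \<open>G\<close>
  and the linear term are bounded separately.\<close>

lemma beta_cdf_linearization:
  assumes m: "0 < m" "m < 1" and u: "0 \<le> u" "u \<le> 1"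
  shows "\<bar>G u - G m - g m * (u - m)\<bar> \<le> K * (m * (1 - m)) powr (\<rho> - 2) * (u - m)\<^sup>2"
proof -
  let ?d = "m * (1 - m)" and ?r = "\<bar>u - m\<bar>"
  have d: "?d > 0" using m by simp
  show ?thesis
  proof (cases "?r \<le> ?d / 2")
    case True
    have ball: "\<bar>t - m\<bar> \<le> ?d / 2" if "t \<in> cball m ?r" for t
      using that True by (simp add: dist_real_def abs_minus_commute)
    let ?D = "D * ?d powr (\<rho> - 2)"
    note inside = deriv_beta_density_le[OF m ball]
    have g_bound: "\<bar>g t - g m\<bar> \<le> ?D * ?r" if t: "t \<in> cball m ?r" for t
    proof -
      have "norm (g t - g m) \<le> ?D * norm (t - m)"
      proof (rule field_differentiable_bound[of "cball m ?r"])
        show "(g has_field_derivative g z * ((\<alpha> - 1) / z - (\<beta> - 1) / (1 - z))) (at z within cball m ?r)"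
          if "z \<in> cball m ?r" for z
          by (rule has_field_derivative_at_within[OF beta_density_has_real_derivative[OF \<alpha> \<beta> inside(1)[OF that] inside(2)[OF that]]])
        show "norm (g z * ((\<alpha> - 1) / z - (\<beta> - 1) / (1 - z))) \<le> ?D" if "z \<in> cball m ?r" for z
          using inside(3)[OF that] by simp
      qed (use t in auto)
      also have "\<dots> \<le> ?D * ?r"
        using t D_nonneg by (intro mult_left_mono) (auto simp: dist_real_def abs_minus_commute)
      finally show ?thesis by simp
    qed
    have "norm ((G u - g m * u) - (G m - g m * m)) \<le> ?D * ?r * norm (u - m)"
    proof (rule field_differentiable_bound[of "cball m ?r"])
      show "((\<lambda>t. G t - g m * t) has_field_derivative (g z - g m)) (at z within cball m ?r)"
        if "z \<in> cball m ?r" for z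
      proof (rule has_field_derivative_at_within)
        have "(G has_field_derivative g z) (at z)"
          by (rule beta_cdf_has_real_derivative[OF \<alpha> \<beta> inside(1)[OF that] inside(2)[OF that]])
        then show "((\<lambda>t. G t - g m * t) has_field_derivative (g z - g m)) (at z)"
          by (auto intro!: derivative_eq_intros)
      qed
      show "norm (g z - g m) \<le> ?D * ?r" if "z \<in> cball m ?r" for z
        using g_bound[OF that] by simp
    qed (auto simp: dist_real_def abs_minus_commute)
    then have "\<bar>(G u - g m * u) - (G m - g m * m)\<bar> \<le> ?D * ?r * ?r"
      by simp
    also have "\<dots> = D * (?d powr (\<rho> - 2) * (u - m)\<^sup>2)"
      by (simp add: power2_eq_square mult.assoc)
    also have "\<dots> \<le> K * (?d powr (\<rho> - 2) * (u - m)\<^sup>2)"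
      using H_pos B_pos by (intro mult_right_mono) (auto simp: K_def)
    finally show ?thesis by (simp add: algebra_simps)
  next
    case False
    \<comment> \<open>As \<rho> - 2 < 0, a lower bound on \<open>?r\<close> bounds
      \<open>?r powr (\<rho> - 2)\<close> from above; the remaining two powers of \<open>?r\<close>
      form the square.\<close>
    then have r: "?r > ?d / 2" "?r > 0" using d by linarith+
    have "\<bar>G u - G m\<bar> \<le> H * ?r powr \<rho>" by (rule beta_cdf_Hoelder)
    also have "?r powr \<rho> = ?r powr (\<rho> - 2) * ?r powr 2"
      using powr_add[of ?r "\<rho> - 2" 2] by simp
    also have "?r powr 2 = (u - m)\<^sup>2" using r by simp
    also have "H * (?r powr (\<rho> - 2) * (u - m)\<^sup>2) \<le> H * (4 * ?d powr (\<rho> - 2) * (u - m)\<^sup>2)"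
    proof (intro mult_left_mono mult_right_mono)
      have "?r powr (\<rho> - 2) \<le> (?d / 2) powr (\<rho> - 2)"
        using r d \<rho> by (intro powr_mono2') auto
      also have "\<dots> = (1 / 2) powr (\<rho> - 2) * ?d powr (\<rho> - 2)"
        using powr_mult[of "1 / 2" ?d "\<rho> - 2"] d by simp
      also have "\<dots> \<le> (1 / 2) powr (- 2) * ?d powr (\<rho> - 2)"
        using \<rho> by (intro mult_right_mono powr_mono') auto
      also have "(1 / 2) powr (- 2) = (4 :: real)" by (simp add: powr_minus_divide power2_eq_square)
      finally show "?r powr (\<rho> - 2) \<le> 4 * ?d powr (\<rho> - 2)" .
    qed (use H_pos in auto)
    finally have 1: "\<bar>G u - G m\<bar> \<le> 4 * H * (?d powr (\<rho> - 2) * (u - m)\<^sup>2)"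
      by (simp add: mult_ac)
    \<comment> \<open>One factor \<open>?d\<close> is split off the density bound and replaced by
      the larger \<open>2 * ?r\<close>.\<close>
    have "\<bar>g m * (u - m)\<bar> \<le> ?d powr (\<rho> - 1) / B * ?r"
      unfolding abs_mult using beta_density_le[OF m] beta_density_nonneg[OF \<alpha> \<beta>, of m] by (intro mult_right_mono) auto
    also have "?d powr (\<rho> - 1) = ?d powr (\<rho> - 2) * ?d"
      using d powr_add[of ?d "\<rho> - 2" 1] by simp
    also have "?d powr (\<rho> - 2) * ?d / B * ?r \<le> ?d powr (\<rho> - 2) * (2 * ?r) / B * ?r"
      using r B_pos by (intro mult_right_mono divide_right_mono mult_left_mono) auto
    also have "\<dots> = 2 / B * (?d powr (\<rho> - 2) * (u - m)\<^sup>2)"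
      by (simp add: power2_eq_square mult_ac)
    finally have 2: "\<bar>g m * (u - m)\<bar> \<le> 2 / B * (?d powr (\<rho> - 2) * (u - m)\<^sup>2)" .
    have "\<bar>G u - G m - g m * (u - m)\<bar> \<le> (4 * H + 2 / B) * (?d powr (\<rho> - 2) * (u - m)\<^sup>2)"
      unfolding distrib_right using abs_triangle_ineq4[of "G u - G m" "g m * (u - m)"] 1 2 by linarith
    also have "\<dots> \<le> K * (?d powr (\<rho> - 2) * (u - m)\<^sup>2)"
      using D_nonneg by (intro mult_right_mono) (auto simp: K_def)
    finally show ?thesis by (simp add: mult.assoc)
  qed
qed

text \<open>Integrating the linearization against the order statistic density removes the linear
  term, as m is the mean, and leaves K (m (1 - m)) powr (\<rho> - 1) / (n + 2) from the
  variance.\<close>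

lemma beta_binomial_cdf_close:
  fixes k n :: nat
  assumes k: "k < n"
  shows "\<bar>(\<Sum>j\<le>k. beta_binomial \<alpha> \<beta> n j) - G (real (Suc k) / real (Suc n))\<bar> \<le> 4 * K * real n powr (- \<rho>)"
proof -
  let ?S = "\<Sum>j\<le>k. beta_binomial \<alpha> \<beta> n j"
  define m where "m = real (Suc k) / real (Suc n)"
  define b where "b = (\<lambda>w :: real. real (n - k) * real (n choose k) * w ^ k * (1 - w) ^ (n - Suc k))"
  have int_b: "(b has_integral 1) {0..1}" "((\<lambda>w. b w * (w - m)) has_integral 0) {0..1}"
    and var: "((\<lambda>w. b w * (w - m)\<^sup>2) has_integral m * (1 - m) / real (n + 2)) {0..1}"
    using order_statistic_moments[OF k] by (simp_all add: m_def b_def)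
  have int_S: "((\<lambda>w. b w * G w) has_integral ?S) {0..1}"
    using has_integral_beta_binomial_cdf[OF \<alpha> \<beta> k] by (simp add: b_def)
  let ?d = "m * (1 - m)"
  have m: "0 < m" "m < 1" using k by (auto simp: m_def)
  then have d: "?d > 0" by simp
  have b_nonneg: "b w \<ge> 0" if "w \<in> {0..1}" for w
    using that by (simp add: b_def)
  have "((\<lambda>w. b w * G w - G m * b w - g m * (b w * (w - m))) has_integral ?S - G m * 1 - g m * 0) {0..1}"
    by (intro has_integral_diff has_integral_mult_right int_S int_b)
  also have "(\<lambda>w. b w * G w - G m * b w - g m * (b w * (w - m))) = (\<lambda>w. b w * (G w - G m - g m * (w - m)))"
    by (simp add: fun_eq_iff algebra_simps)
  finally have int_f: "((\<lambda>w. b w * (G w - G m - g m * (w - m))) has_integral ?S - G m) {0..1}"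
    by simp
  have int_V: "((\<lambda>w. K * ?d powr (\<rho> - 2) * (b w * (w - m)\<^sup>2)) has_integral
      K * ?d powr (\<rho> - 2) * (?d / real (n + 2))) {0..1}"
    by (intro has_integral_mult_right var)
  have "norm (b w * (G w - G m - g m * (w - m))) \<le> K * ?d powr (\<rho> - 2) * (b w * (w - m)\<^sup>2)"
    if "w \<in> {0..1}" for w
  proof -
    have "norm (b w * (G w - G m - g m * (w - m))) = b w * \<bar>G w - G m - g m * (w - m)\<bar>"
      using b_nonneg[OF that] by (simp add: abs_mult)
    also have "\<dots> \<le> b w * (K * ?d powr (\<rho> - 2) * (w - m)\<^sup>2)"
      using that by (intro mult_left_mono beta_cdf_linearization m b_nonneg) auto
    finally show ?thesis by (simp add: mult_ac)
  qed
  from integral_norm_bound_integral[OF has_integral_integrable[OF int_f] has_integral_integrable[OF int_V] this]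
  have "\<bar>?S - G m\<bar> \<le> K * ?d powr (\<rho> - 2) * (?d / real (n + 2))"
    by (simp only: integral_unique[OF int_f] integral_unique[OF int_V] real_norm_def)
  also have "\<dots> = K * (?d powr (\<rho> - 1) / real (n + 2))"
    using powr_add[of ?d "\<rho> - 2" 1] d by simp
  also have "\<dots> \<le> K * (4 * real n powr (1 - \<rho>) / real n)"
  proof (intro mult_left_mono frac_le)
    \<comment> \<open>Attained at k = 0 and k = n - 1. It gives m (1 - m) \<ge> 1 / (4 n), which the
      exponent \<rho> - 1 \<le> 0 turns into an upper bound.\<close>
    have "real (Suc k) * real (n - k) \<ge> real n"
    proof -
      have "Suc k * (n - k) = n + k * (n - Suc k)"
      proof -
        obtain l where "n = Suc (k + l)" using k less_iff_Suc_add by auto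
        then show ?thesis by (simp add: algebra_simps)
      qed
      then show ?thesis by (metis le_add1 of_nat_le_iff of_nat_mult)
    qed
    moreover have "?d = real (Suc k) * real (n - k) / (real (Suc n))\<^sup>2"
      using k by (simp add: m_def power2_eq_square field_simps of_nat_diff)
    moreover have "(real (Suc n))\<^sup>2 \<le> (2 * real n)\<^sup>2"
      using k by (intro power_mono) auto
    ultimately have "?d \<ge> real n / (2 * real n)\<^sup>2"
      using k by (auto intro!: frac_le)
    also have "real n / (2 * real n)\<^sup>2 = 1 / (4 * real n)"
      using k by (simp add: power2_eq_square)
    finally have "?d powr (\<rho> - 1) \<le> (1 / (4 * real n)) powr (\<rho> - 1)"
      using k \<rho> by (intro powr_mono2') auto
    also have "\<dots> = (4 * real n) powr (1 - \<rho>)"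
      using k powr_minus[of "4 * real n" "\<rho> - 1"] by (simp add: powr_divide inverse_eq_divide)
    also have "\<dots> = 4 powr (1 - \<rho>) * real n powr (1 - \<rho>)"
      by (simp add: powr_mult)
    also have "\<dots> \<le> 4 powr 1 * real n powr (1 - \<rho>)"
      using \<rho> by (intro mult_right_mono powr_mono) auto
    finally show "?d powr (\<rho> - 1) \<le> 4 * real n powr (1 - \<rho>)" by simp
  qed (use k K_pos in auto)
  also have "\<dots> = 4 * K * real n powr (- \<rho>)"
    using k powr_diff[of "real n" "1 - \<rho>" 1] by simp
  finally show ?thesis by (simp add: m_def)
qed

text \<open>The step function is compared with \<open>G\<close> at the mean z of the matching order
  statistic, and Hoelder continuity pays for moving from z to x over a distance of order 1 /
  n.\<close>

lemma shifted_cdf_close: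
  assumes st: "0 \<le> s" "s \<le> t" and n: "n \<ge> 1"
  shows "\<bar>shifted_cdf \<alpha> \<beta> s t n x - G x\<bar> \<le> (4 * K + H * (s + t + 2)) * real n powr (- \<rho>)"
proof -
  define y where "y = (real n + t) * x - s"
  have nt: "real n + t > 0" using st n by simp
  have iff: "(real k + s) / (real n + t) \<le> x \<longleftrightarrow> real k \<le> y" for k
    using nt by (simp add: y_def field_simps)
  have x: "x = (y + s) / (real n + t)" using nt by (simp add: y_def)
  \<comment> \<open>z is 0 below the support, 1 from its last point on, and (k + 1) / (n + 1)
    between. The alternative \<open>G z = G x\<close> covers x outside the unit interval, possibly
    far from z.\<close>
  have "\<exists>z. \<bar>shifted_cdf \<alpha> \<beta> s t n x - G z\<bar> \<le> 4 * K * real n powr (- \<rho>) \<and>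
      (G z = G x \<or> \<bar>z - x\<bar> \<le> (s + t + 2) / real n)"
  proof -
    consider "y < 0" | "y \<ge> real n" | "0 \<le> y" "y < real n" by linarith
    then show ?thesis
    proof cases
      case 1
      then have "shifted_cdf \<alpha> \<beta> s t n x = 0"
        unfolding shifted_cdf_def iff by (intro sum.neutral) auto
      moreover have "\<bar>0 - x\<bar> \<le> (s + t + 2) / real n" if "x \<ge> 0"
      proof -
        have "x \<le> s / (real n + t)" unfolding x using 1 nt by (intro divide_right_mono) auto
        also have "\<dots> \<le> (s + t + 2) / real n" using st n by (intro frac_le) auto
        finally show ?thesis using that by simp
      qed
      ultimately show ?thesis
        using beta_cdf_0[OF \<alpha> \<beta>, of 0] beta_cdf_0[OF \<alpha> \<beta>, of x] K_pos
        by (intro exI[of _ 0], cases "x \<ge> 0") auto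
    next
      case 2
      then have "shifted_cdf \<alpha> \<beta> s t n x = 1"
        unfolding shifted_cdf_def iff beta_binomial_sum[OF \<alpha> \<beta>, of n, symmetric]
        by (intro sum.cong) auto
      moreover have "\<bar>1 - x\<bar> \<le> (s + t + 2) / real n" if "x \<le> 1"
      proof -
        have "1 - x = (real n + t - (y + s)) / (real n + t)"
          unfolding x using nt by (simp add: diff_divide_distrib)
        also have "\<dots> \<le> (s + t + 2) / real n" using st n 2 by (intro frac_le) auto
        finally show ?thesis using that by simp
      qed
      ultimately show ?thesis
        using beta_cdf_1[OF \<alpha> \<beta>, of 1] beta_cdf_1[OF \<alpha> \<beta>, of x] K_pos
        by (intro exI[of _ 1], cases "x \<le> 1") auto
    next
      case 3
      define k where "k = nat \<lfloor>y\<rfloor>"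
      have k: "real k \<le> y" "y < real k + 1" "k < n"
        using 3 unfolding k_def by linarith+
      have "real j \<le> y \<longleftrightarrow> j \<le> k" for j
        using k by linarith
      then have "shifted_cdf \<alpha> \<beta> s t n x = (\<Sum>j\<le>k. beta_binomial \<alpha> \<beta> n j)"
        unfolding shifted_cdf_def iff using k(3) by (intro sum.mono_neutral_cong_right) auto
      moreover define z where "z = real (Suc k) / real (Suc n)"
      have "z * (real n + 1) = real k + 1" "0 \<le> z" "z \<le> 1"
        using k(3) by (simp_all add: z_def field_simps)
      moreover have "x * (real n + t) = y + s" using nt by (simp add: x)
      \<comment> \<open>Here 0 < k + 1 - y \<le> 1; together with s and the bound t + 1 on the last
        term this gives s + t + 2.\<close>
      ultimately have "(z - x) * (real n + t) = real k + 1 - y - s + (t - 1) * z"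
        by (simp add: algebra_simps)
      moreover have "\<bar>(t - 1) * z\<bar> \<le> t + 1"
      proof -
        have "\<bar>(t - 1) * z\<bar> \<le> \<bar>t - 1\<bar> * 1"
          unfolding abs_mult using \<open>0 \<le> z\<close> \<open>z \<le> 1\<close> by (intro mult_left_mono) auto
        also have "\<dots> \<le> t + 1" using st by auto
        finally show ?thesis .
      qed
      ultimately have "\<bar>(z - x) * (real n + t)\<bar> \<le> s + t + 2"
        using k st by linarith
      then have "\<bar>z - x\<bar> * (real n + t) \<le> s + t + 2"
        using nt by (simp add: abs_mult)
      then have "\<bar>z - x\<bar> \<le> (s + t + 2) / (real n + t)"
        using nt by (simp add: field_simps)
      also have "\<dots> \<le> (s + t + 2) / real n"
        using st n by (intro divide_left_mono) auto
      finally show ?thesis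
        using beta_binomial_cdf_close[OF k(3)]
          \<open>shifted_cdf \<alpha> \<beta> s t n x = (\<Sum>j\<le>k. beta_binomial \<alpha> \<beta> n j)\<close>
        by (intro exI[of _ z]) (auto simp: z_def)
    qed
  qed
  then obtain z where z: "\<bar>shifted_cdf \<alpha> \<beta> s t n x - G z\<bar> \<le> 4 * K * real n powr (- \<rho>)"
    "G z = G x \<or> \<bar>z - x\<bar> \<le> (s + t + 2) / real n" by blast
  have "\<bar>G z - G x\<bar> \<le> H * (s + t + 2) * real n powr (- \<rho>)"
  proof (cases "G z = G x")
    case True
    then show ?thesis using st H_pos by simp
  next
    case False
    have "\<bar>G z - G x\<bar> \<le> H * \<bar>z - x\<bar> powr \<rho>" by (rule beta_cdf_Hoelder)
    also have "\<dots> \<le> H * ((s + t + 2) / real n) powr \<rho>"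
      using z(2) False \<rho> H_pos by (intro mult_left_mono powr_mono2) auto
    also have "\<dots> = H * ((s + t + 2) powr \<rho> * real n powr (- \<rho>))"
      using st by (simp add: powr_divide powr_minus_divide)
    \<comment> \<open>The base is at least 1, so raising the exponent from \<rho> to 1 enlarges the
      power.\<close>
    also have "\<dots> \<le> H * ((s + t + 2) powr 1 * real n powr (- \<rho>))"
      using st \<rho> H_pos by (intro mult_left_mono mult_right_mono powr_mono) auto
    finally show ?thesis using st by simp
  qed
  with z(1) show ?thesis unfolding distrib_right by linarith
qed

text \<open>Since \<open>G\<close> has no jumps, half of each atom is a lower bound for the distance.\<close>

lemma atom_le_twice_distance:
  assumes st: "0 \<le> s" "s \<le> t" and n: "n \<ge> 1" and k: "k \<le> n"
    and r: "\<And>x. \<bar>shifted_cdf \<alpha> \<beta> s t n x - G x\<bar> \<le> r"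
  shows "beta_binomial \<alpha> \<beta> n k \<le> 2 * r"
proof (rule field_le_epsilon)
  fix e :: real assume e: "e > 0"
  let ?z = "(real k + s) / (real n + t)"
  \<comment> \<open>Chosen so that the Hoelder bound over a step of length \<delta> is exactly
    e.\<close>
  define \<delta> where "\<delta> = (e / H) powr (1 / \<rho>)"
  have \<delta>: "\<delta> > 0" "\<delta> powr \<rho> = e / H"
    using e H_pos \<rho> by (auto simp: \<delta>_def powr_powr)
  \<comment> \<open>Indicator of the support points in the half-open interval from
    \<open>?z - \<delta>\<close> to \<open>?z\<close>, among them the k-th.\<close>
  let ?u = "\<lambda>j. of_bool ((real j + s) / (real n + t) \<le> ?z) - of_bool ((real j + s) / (real n + t) \<le> ?z - \<delta>) :: real"
  have "beta_binomial \<alpha> \<beta> n k = beta_binomial \<alpha> \<beta> n k * ?u k"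
    using \<delta> by simp
  also have "\<dots> \<le> (\<Sum>j\<le>n. beta_binomial \<alpha> \<beta> n j * ?u j)"
  proof (rule member_le_sum)
    show "0 \<le> beta_binomial \<alpha> \<beta> n j * ?u j" for j
      using \<delta> beta_binomial_nonneg[OF \<alpha> \<beta>, of n j] by (intro mult_nonneg_nonneg) auto
  qed (use k in auto)
  also have "\<dots> = shifted_cdf \<alpha> \<beta> s t n ?z - shifted_cdf \<alpha> \<beta> s t n (?z - \<delta>)"
    by (simp add: shifted_cdf_def right_diff_distrib sum_subtractf)
  also have "\<dots> \<le> 2 * r + \<bar>G ?z - G (?z - \<delta>)\<bar>"
    using r[of ?z] r[of "?z - \<delta>"] by linarith
  also have "\<bar>G ?z - G (?z - \<delta>)\<bar> \<le> e"
    using beta_cdf_Hoelder[of ?z "?z - \<delta>"] \<delta> H_pos by simp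
  finally show "beta_binomial \<alpha> \<beta> n k \<le> 2 * r + e" by simp
qed

lemma ks_dist_bounds:
  assumes st: "0 \<le> s" "s \<le> t" and n: "n \<ge> 1"
    and Z: "\<And>x. \<P>(\<omega> in M. Z \<omega> \<le> x) = shifted_cdf \<alpha> \<beta> s t n x"
    and W: "\<And>x. \<P>(\<omega> in N. W \<omega> \<le> x) = G x"
  shows "k \<le> n \<Longrightarrow> beta_binomial \<alpha> \<beta> n k \<le> 2 * ks_dist M Z N W"
    and "ks_dist M Z N W \<le> (4 * K + H * (s + t + 2)) * real n powr (- \<rho>)"
proof -
  let ?f = "\<lambda>x. \<bar>shifted_cdf \<alpha> \<beta> s t n x - G x\<bar>"
  have ks: "ks_dist M Z N W = (SUP x. ?f x)"
    by (simp add: ks_dist_def Z W)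
  show "ks_dist M Z N W \<le> (4 * K + H * (s + t + 2)) * real n powr (- \<rho>)"
    unfolding ks by (intro cSUP_least shifted_cdf_close st n) auto
  \<comment> \<open>A real supremum dominates its members only if they are bounded; the upper
    estimate supplies this.\<close>
  have "bdd_above (range ?f)"
    using shifted_cdf_close[OF st n] by (intro bdd_aboveI2)
  then have "?f x \<le> ks_dist M Z N W" for x
    unfolding ks by (intro cSUP_upper) auto
  then show "beta_binomial \<alpha> \<beta> n k \<le> 2 * ks_dist M Z N W" if "k \<le> n"
    by (rule atom_le_twice_distance[OF st n that])
qed

end

section \<open>Uniform constants and the urn\<close>

text \<open>T caps s + t, so the constants are fixed before the shifts and serve both urn
  statistics.\<close>

lemma ks_dist_beta_binomial:
  assumes \<alpha>: "\<alpha> > 0" and \<beta>: "\<beta> > 0"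
  shows "\<exists>c C. c > 0 \<and> (\<forall>(M :: 'w measure) Z (N :: 'v measure) W s t n.
    0 \<le> s \<longrightarrow> s \<le> t \<longrightarrow> s + t \<le> T \<longrightarrow> n \<ge> 1 \<longrightarrow>
    (\<forall>x. \<P>(\<omega> in M. Z \<omega> \<le> x) = shifted_cdf \<alpha> \<beta> s t n x) \<longrightarrow>
    (\<forall>x. \<P>(\<omega> in N. W \<omega> \<le> x) = beta_cdf \<alpha> \<beta> x) \<longrightarrow>
    c * real n powr (- Min {\<alpha>, \<beta>, 1}) \<le> ks_dist M Z N W \<and>
    ks_dist M Z N W \<le> C * real n powr (- Min {\<alpha>, \<beta>, 1}))"
proof -
  interpret beta_exponent \<alpha> \<beta> "Min {\<alpha>, \<beta>, 1}"
    by unfold_locales (use \<alpha> \<beta> in auto)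
  obtain c where c: "c > 0"
    "\<And>n. n \<ge> 1 \<Longrightarrow> \<exists>k\<le>n. c * real n powr (- Min {\<alpha>, \<beta>, 1}) \<le> beta_binomial \<alpha> \<beta> n k"
    using beta_binomial_atom_lower_bound[OF \<alpha> \<beta>] by blast
  have "c / 2 * real n powr (- Min {\<alpha>, \<beta>, 1}) \<le> ks_dist M Z N W \<and>
      ks_dist M Z N W \<le> (4 * K + H * (T + 2)) * real n powr (- Min {\<alpha>, \<beta>, 1})"
    if st: "0 \<le> s" "s \<le> t" "s + t \<le> T" and n: "n \<ge> 1"
      and Z: "\<And>x. \<P>(\<omega> in M. Z \<omega> \<le> x) = shifted_cdf \<alpha> \<beta> s t n x"
      and W: "\<And>x. \<P>(\<omega> in N. W \<omega> \<le> x) = G x"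
    for M :: "'w measure" and Z and N :: "'v measure" and W s t n
  proof
    obtain k where k: "k \<le> n" "c * real n powr (- Min {\<alpha>, \<beta>, 1}) \<le> beta_binomial \<alpha> \<beta> n k"
      using c(2)[OF n] by blast
    then show "c / 2 * real n powr (- Min {\<alpha>, \<beta>, 1}) \<le> ks_dist M Z N W"
      using ks_dist_bounds(1)[OF st(1,2) n Z W k(1)] by linarith
    have "ks_dist M Z N W \<le> (4 * K + H * (s + t + 2)) * real n powr (- Min {\<alpha>, \<beta>, 1})"
      by (rule ks_dist_bounds(2)[OF st(1,2) n Z W])
    also have "\<dots> \<le> (4 * K + H * (T + 2)) * real n powr (- Min {\<alpha>, \<beta>, 1})"
      using st H_pos by (intro mult_right_mono add_left_mono mult_left_mono) auto
    finally show "ks_dist M Z N W \<le> (4 * K + H * (T + 2)) * real n powr (- Min {\<alpha>, \<beta>, 1})" .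
  qed
  then show ?thesis
    using c(1) by (intro exI[of _ "c / 2"] exI[of _ "4 * K + H * (T + 2)"]) simp
qed

lemma (in polya_urn) prob_draws_le:
  fixes i :: 'q
  assumes a: "a > 0" and x0: "\<And>j. x0 $ j > 0"
  defines "\<alpha> \<equiv> x0 $ i / a" and "\<beta> \<equiv> (l1_norm x0 - x0 $ i) / a"
  assumes \<beta>: "\<beta> > 0"
  shows "\<P>(\<omega> in M. real (draws a X n i \<omega>) / real n \<le> x) = shifted_cdf \<alpha> \<beta> 0 0 n x"
    and "\<P>(\<omega> in M. X n \<omega> $ i / l1_norm (X n \<omega>) \<le> x) = shifted_cdf \<alpha> \<beta> \<alpha> (\<alpha> + \<beta>) n x"
proof -
  note law = prob_draws[OF a x0 \<beta>[unfolded \<beta>_def], folded \<alpha>_def \<beta>_def]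
  show "\<P>(\<omega> in M. real (draws a X n i \<omega>) / real n \<le> x) = shifted_cdf \<alpha> \<beta> 0 0 n x"
    using law[of "\<lambda>k. real k / real n \<le> x" n] by (simp add: shifted_cdf_def)
  have "\<P>(\<omega> in M. X n \<omega> $ i / l1_norm (X n \<omega>) \<le> x) =
      \<P>(\<omega> in M. (real (draws a X n i \<omega>) + \<alpha>) / (real n + (\<alpha> + \<beta>)) \<le> x)"
    using AE_proportion[OF a x0 \<beta>[unfolded \<beta>_def], of n, folded \<alpha>_def \<beta>_def]
    by (intro prob_eq_AE) (auto elim!: eventually_mono)
  also have "\<dots> = shifted_cdf \<alpha> \<beta> \<alpha> (\<alpha> + \<beta>) n x"
    using law[of "\<lambda>k. (real k + \<alpha>) / (real n + (\<alpha> + \<beta>)) \<le> x" n] by (simp add: shifted_cdf_def)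
  finally show "\<P>(\<omega> in M. X n \<omega> $ i / l1_norm (X n \<omega>) \<le> x) = shifted_cdf \<alpha> \<beta> \<alpha> (\<alpha> + \<beta>) n x" .
qed

theorem theorem1p4:
  fixes a :: real and x0 :: "real ^ 'q"
  assumes "CARD('q) \<ge> 2" and "a > 0" and "\<And>j. x0 $ j > 0"
  shows "\<exists>c C :: real. 0 < c \<and> c \<le> C \<and>
    (\<forall>(M :: 'w measure) (X :: nat \<Rightarrow> 'w \<Rightarrow> real ^ 'q) (i :: 'q) (N :: 'v measure) (W :: 'v \<Rightarrow> real).
      polya_urn M a x0 X \<longrightarrow> prob_space N \<longrightarrow>
      distributed N lborel W (beta_density (x0 $ i / a) ((l1_norm x0 - x0 $ i) / a)) \<longrightarrow>
      (let \<rho> = Min {x0 $ i / a, (l1_norm x0 - x0 $ i) / a, 1} in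
        \<forall>n\<ge>1.
          c * real n powr (- \<rho>) \<le> ks_dist M (\<lambda>\<omega>. X n \<omega> $ i / l1_norm (X n \<omega>)) N W \<and>
          ks_dist M (\<lambda>\<omega>. X n \<omega> $ i / l1_norm (X n \<omega>)) N W \<le> C * real n powr (- \<rho>) \<and>
          c * real n powr (- \<rho>) \<le> ks_dist M (\<lambda>\<omega>. real (draws a X n i \<omega>) / real n) N W \<and>
          ks_dist M (\<lambda>\<omega>. real (draws a X n i \<omega>) / real n) N W \<le> C * real n powr (- \<rho>)))"
proof -
  define \<alpha> \<beta> where "\<alpha> = (\<lambda>i. x0 $ i / a)" and "\<beta> = (\<lambda>i. (l1_norm x0 - x0 $ i) / a)"
  have \<alpha>: "\<alpha> i > 0" for i
    using assms by (simp add: \<alpha>_def)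
  \<comment> \<open>A second colour exists and contributes a positive amount to the total beyond
    \<open>x0 $ i\<close>.\<close>
  have \<beta>: "\<beta> i > 0" for i
  proof -
    have "UNIV \<noteq> {i}"
    proof
      assume "UNIV = {i}"
      then have "CARD('q) = card {i}" by simp
      with assms(1) show False by simp
    qed
    then obtain j where "j \<noteq> i" by auto
    then have "0 < (\<Sum>j\<in>UNIV - {i}. \<bar>x0 $ j\<bar>)"
      using assms(3)[of j] by (intro sum_pos2[of _ j]) auto
    moreover have "l1_norm x0 = \<bar>x0 $ i\<bar> + (\<Sum>j\<in>UNIV - {i}. \<bar>x0 $ j\<bar>)"
      unfolding l1_norm_def by (rule sum.remove) auto
    ultimately show ?thesis using assms(2) assms(3)[of i] by (simp add: \<beta>_def)
  qed
  let ?r = "\<lambda>i n. real n powr (- Min {\<alpha> i, \<beta> i, 1})"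
  \<comment> \<open>The cap \<open>2 * \<alpha> i + \<beta> i\<close> is s + t for the urn
    proportion; the draw frequency has s + t = 0.\<close>
  have "\<forall>i. \<exists>c C. c > 0 \<and> (\<forall>(M :: 'w measure) Z (N :: 'v measure) W s t n.
      0 \<le> s \<longrightarrow> s \<le> t \<longrightarrow> s + t \<le> 2 * \<alpha> i + \<beta> i \<longrightarrow> n \<ge> 1 \<longrightarrow>
      (\<forall>x. \<P>(\<omega> in M. Z \<omega> \<le> x) = shifted_cdf (\<alpha> i) (\<beta> i) s t n x) \<longrightarrow>
      (\<forall>x. \<P>(\<omega> in N. W \<omega> \<le> x) = beta_cdf (\<alpha> i) (\<beta> i) x) \<longrightarrow>
      c * ?r i n \<le> ks_dist M Z N W \<and> ks_dist M Z N W \<le> C * ?r i n)"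
    by (intro allI ks_dist_beta_binomial \<alpha> \<beta>)
  then obtain c C where c: "\<And>i. c i > 0"
    and bounds: "\<And>i (M :: 'w measure) Z (N :: 'v measure) W s t n.
      0 \<le> s \<Longrightarrow> s \<le> t \<Longrightarrow> s + t \<le> 2 * \<alpha> i + \<beta> i \<Longrightarrow> n \<ge> 1 \<Longrightarrow>
      (\<And>x. \<P>(\<omega> in M. Z \<omega> \<le> x) = shifted_cdf (\<alpha> i) (\<beta> i) s t n x) \<Longrightarrow>
      (\<And>x. \<P>(\<omega> in N. W \<omega> \<le> x) = beta_cdf (\<alpha> i) (\<beta> i) x) \<Longrightarrow>
      c i * ?r i n \<le> ks_dist M Z N W \<and> ks_dist M Z N W \<le> C i * ?r i n"
    unfolding choice_iff by blast
  \<comment> \<open>There are finitely many colours, so extreme constants serve all of them;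
    inserting \<open>c0\<close> into the maximum ensures \<open>c0 \<le> C0\<close>.\<close>
  define c0 C0 where "c0 = Min (range c)" and "C0 = Max (insert c0 (range C))"
  have c0: "c0 > 0" "\<And>i. c0 \<le> c i" and C0: "c0 \<le> C0"
    using c by (auto simp: c0_def C0_def)
  have C_le: "C i \<le> C0" for i
    unfolding C0_def by (rule Max_ge) auto
  have uniform: "c0 * ?r i n \<le> ks_dist M Z N W \<and> ks_dist M Z N W \<le> C0 * ?r i n"
    if "0 \<le> s" "s \<le> t" "s + t \<le> 2 * \<alpha> i + \<beta> i" "n \<ge> 1"
      "\<And>x. \<P>(\<omega> in M. Z \<omega> \<le> x) = shifted_cdf (\<alpha> i) (\<beta> i) s t n x"
      "\<And>x. \<P>(\<omega> in N. W \<omega> \<le> x) = beta_cdf (\<alpha> i) (\<beta> i) x"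
    for i and M :: "'w measure" and Z and N :: "'v measure" and W s t n
  proof -
    have "c0 * ?r i n \<le> c i * ?r i n" "C i * ?r i n \<le> C0 * ?r i n"
      using c0 C_le by (auto intro!: mult_right_mono)
    with bounds[OF that] show ?thesis by linarith
  qed
  show ?thesis
  proof (rule exI[of _ c0], rule exI[of _ C0], intro conjI allI impI)
    fix M :: "'w measure" and X :: "nat \<Rightarrow> 'w \<Rightarrow> real ^ 'q" and i :: 'q
      and N :: "'v measure" and W :: "'v \<Rightarrow> real"
    assume urn: "polya_urn M a x0 X" and N: "prob_space N"
      and W: "distributed N lborel W (beta_density (x0 $ i / a) ((l1_norm x0 - x0 $ i) / a))"
    have W': "\<P>(\<omega> in N. W \<omega> \<le> x) = beta_cdf (\<alpha> i) (\<beta> i) x" for x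
      using prob_beta_le[OF \<alpha> \<beta> N, of W i i x] W by (simp add: \<alpha>_def \<beta>_def)
    have \<beta>i: "(l1_norm x0 - x0 $ i) / a > 0" using \<beta>[of i] by (simp add: \<beta>_def)
    have law: "\<P>(\<omega> in M. real (draws a X n i \<omega>) / real n \<le> x) = shifted_cdf (\<alpha> i) (\<beta> i) 0 0 n x"
      "\<P>(\<omega> in M. X n \<omega> $ i / l1_norm (X n \<omega>) \<le> x) = shifted_cdf (\<alpha> i) (\<beta> i) (\<alpha> i) (\<alpha> i + \<beta> i) n x"
      for n x
      unfolding \<alpha>_def \<beta>_def by (rule polya_urn.prob_draws_le[OF urn assms(2,3) \<beta>i])+
    have "c0 * ?r i n \<le> ks_dist M (\<lambda>\<omega>. X n \<omega> $ i / l1_norm (X n \<omega>)) N W \<and>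
        ks_dist M (\<lambda>\<omega>. X n \<omega> $ i / l1_norm (X n \<omega>)) N W \<le> C0 * ?r i n"
      "c0 * ?r i n \<le> ks_dist M (\<lambda>\<omega>. real (draws a X n i \<omega>) / real n) N W \<and>
        ks_dist M (\<lambda>\<omega>. real (draws a X n i \<omega>) / real n) N W \<le> C0 * ?r i n"
      if "n \<ge> 1" for n
      using \<alpha>[of i] \<beta>[of i] that
      by (intro uniform[where s = "\<alpha> i" and t = "\<alpha> i + \<beta> i"] uniform[where s = 0 and t = 0] law W'; simp)+
    then show "let \<rho> = Min {x0 $ i / a, (l1_norm x0 - x0 $ i) / a, 1} in
        \<forall>n\<ge>1.
          c0 * real n powr (- \<rho>) \<le> ks_dist M (\<lambda>\<omega>. X n \<omega> $ i / l1_norm (X n \<omega>)) N W \<and>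
          ks_dist M (\<lambda>\<omega>. X n \<omega> $ i / l1_norm (X n \<omega>)) N W \<le> C0 * real n powr (- \<rho>) \<and>
          c0 * real n powr (- \<rho>) \<le> ks_dist M (\<lambda>\<omega>. real (draws a X n i \<omega>) / real n) N W \<and>
          ks_dist M (\<lambda>\<omega>. real (draws a X n i \<omega>) / real n) N W \<le> C0 * real n powr (- \<rho>)"
      unfolding Let_def \<alpha>_def \<beta>_def by blast
  qed (use c0 C0 in auto)
qed

end
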